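(* For every $n\geq 0$, the map $(T,e,\varepsilon)\mapsto \mathrm{Insertpoint}^*(T,e,\varepsilon)$ is a bijection between the set of triples $(T,e,\varepsilon)$ with $T\in\mathcal{T}^{sym}_{2n+1}$, $e$ a lower boundary edge of $T$ and $\varepsilon\in\{+1,-1\}$, and the set $\mathcal{T}^{sym}_{2n+3}$.
   Context: A Ferrers diagram is a finite set of unit cells of $\mathbb{Z}^2$ forming left-justified rows whose lengths weakly decrease from top to bottom, considered up to translation; its boundary edges are the unit edges of its Southeast border path, ordered from Southwest to Northeast. A tree-like tableau is a Ferrers diagram in which each cell is empty or pointed, such that: (1) the top-left cell is pointed (root point); (2) every non-root pointed cell has either a pointed cell above it in its column or a pointed cell to its left in its row, but not both; (3) every row and column contains a pointed cell. Its size is its number of points (= half-perimeter minus 1). A symmetric tableau is a tree-like tableau invariant under reflection through the main diagonal (the diagonal line through the Northwest corner of the top-left cell, going Southeast); its size is odd, and $\mathcal{T}^{sym}_{2n+1}$ denotes the set of symmetric tableaux of size $2n+1$. Lower boundary edges (resp. lower cells/points) are those lying Southwest of (strictly below) the diagonal. The $*$-special point of a symmetric tableau is the Northeast-most among the pointed cells that are the lowest cell of their column and lie Southwest of the diagonal. Inserting a column at a boundary edge at the right end of a row $r$ adds a cell at the right end of $r$ and of every row above $r$; inserting a row at a boundary edge at the bottom of a column $c$ adds a cell at the bottom of $c$ and of every column to its left. A ribbon is a connected (via shared edges) set of cells with no $2\times2$ square whose addition keeps a Ferrers diagram. $\mathrm{Insertpoint}^*(T,e,\varepsilon)$: let $T'$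 be obtained from $T$ by inserting a row (if $e$ is horizontal) or column (if $e$ vertical) at $e$ whose rightmost (resp. lowest) cell is pointed and other new cells empty, together with the symmetric column (resp. row) with its symmetric point. (1) If $\varepsilon=+1$ and $e$ lies Northeast of the $*$-special point (or $T$ has no $*$-special point), the result is $T'$. (2) If $\varepsilon=+1$ and $e$ lies Southwest of the $*$-special point (including the bottom edge of its cell), add to $T'$ the ribbon of empty cells from the cell immediately right of the new lower point to the cell immediately below the $*$-special point of $T$, together with the symmetric ribbon. (3) If $\varepsilon=-1$, add to $T'$ the ribbon of empty cells from the cell immediately right of the new lower point to the cell immediately below the new point above the diagonal. *)

theory Defs
  imports Main
begin

text \<open>
  A cell is written as (row, column), rows counted from top to bottom and columns from left to
  right, both from 0. Diagrams up to translation are represented by the one whose top-left cell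
  is (0, 0).
\<close>

type_synonym cell = "nat \<times> nat"

definition ferrers :: "cell set \<Rightarrow> bool" where
  "ferrers D \<longleftrightarrow> finite D \<and> (\<exists>len :: nat \<Rightarrow> nat. antimono len \<and> D = {(i, j). j < len i})"

text \<open>A tableau is the pair of its set of cells and its set of pointed cells.\<close>

type_synonym tableau = "cell set \<times> cell set"

definition tree_like :: "tableau \<Rightarrow> bool" where
  "tree_like T \<longleftrightarrow> (case T of (D, P) \<Rightarrow>
     ferrers D \<and> P \<subseteq> D \<and> (0, 0) \<in> P \<and>
     (\<forall>(i, j) \<in> P. (i, j) \<noteq> (0, 0) \<longrightarrow>
        ((\<exists>i' < i. (i', j) \<in> P) \<noteq> (\<exists>j' < j. (i, j') \<in> P))) \<and>
     (\<forall>(i, j) \<in> D. (\<exists>j'. (i, j') \<in> P) \<and> (\<exists>i'. (i', j) \<in> P)))"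

definition size_tableau :: "tableau \<Rightarrow> nat" where
  "size_tableau T = card (snd T)"

definition symmetric :: "tableau \<Rightarrow> bool" where
  "symmetric T \<longleftrightarrow> prod.swap ` fst T = fst T \<and> prod.swap ` snd T = snd T"

definition sym_tableaux :: "nat \<Rightarrow> tableau set" where
  "sym_tableaux m = {T. tree_like T \<and> symmetric T \<and> size_tableau T = m}"


text \<open>South c and East c are the bottom edge and the right edge of the cell c.\<close>

datatype edge = South cell | East cell

definition boundary_edges :: "cell set \<Rightarrow> edge set" where
  "boundary_edges D =
     {South (i, j) | i j. (i, j) \<in> D \<and> (i + 1, j) \<notin> D} \<union>
     {East (i, j) | i j. (i, j) \<in> D \<and> (i, j + 1) \<notin> D}"

text \<open>
  The value of x - y at the Southwest endpoint of the edge, where the lattice point (y, x) is the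
  top-left corner of the cell (y, x). Each step (East or North) of the Southeast border path
  increases x - y by one, so this orders the boundary edges from Southwest to Northeast. The main
  diagonal is x - y = 0; an edge from x - y = p to x - y = p + 1 lies Southwest of it iff
  p < 0 (the last lower edge ends on the diagonal).
\<close>

fun position :: "edge \<Rightarrow> int" where
  "position (South (i, j)) = int j - int (i + 1)"
| "position (East (i, j)) = int (j + 1) - int (i + 1)"

definition lower_edges :: "tableau \<Rightarrow> edge set" where
  "lower_edges T = {e \<in> boundary_edges (fst T). position e < 0}"


definition lower_bottom_points :: "tableau \<Rightarrow> cell set" where
  "lower_bottom_points T = {(i, j) \<in> snd T. (i + 1, j) \<notin> fst T \<and> j < i}"

definition is_star_special :: "tableau \<Rightarrow> cell \<Rightarrow> bool" where
  "is_star_special T p \<longleftrightarrow> p \<in> lower_bottom_points T \<and>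
     (\<forall>q \<in> lower_bottom_points T. fst p \<le> fst q \<and> snd q \<le> snd p)"


text \<open>
  Inserting a row at South (a, b) creates a row of index a + 1 with the columns 0, ..., b and
  pushes the rows below it down by one; inserting a column at East (a, b) is the transposed
  operation. The function moved e gives the new place of an old cell.
\<close>

fun moved :: "edge \<Rightarrow> cell \<Rightarrow> cell" where
  "moved (South (a, b)) (i, j) = (if i \<le> a then i else i + 1, j)"
| "moved (East (a, b)) (i, j) = (i, if j \<le> b then j else j + 1)"

fun new_cells :: "edge \<Rightarrow> cell set" where
  "new_cells (South (a, b)) = {(a + 1, j) | j. j \<le> b}"
| "new_cells (East (a, b)) = {(i, b + 1) | i. i \<le> a}"

fun new_point :: "edge \<Rightarrow> cell" where
  "new_point (South (a, b)) = (a + 1, b)"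
| "new_point (East (a, b)) = (a, b + 1)"

definition insert_line :: "edge \<Rightarrow> tableau \<Rightarrow> tableau" where
  "insert_line e T =
     (moved e ` fst T \<union> new_cells e, insert (new_point e) (moved e ` snd T))"

text \<open>
  The mirror image of the edge South (a, b) is East (b, a), and vice versa. For a lower edge e it
  lies Northeast of e, and the insertion at e carries it to the same side of the moved cell.
\<close>

fun moved_mirror :: "edge \<Rightarrow> edge" where
  "moved_mirror (South c) = East (moved (South c) (prod.swap c))"
| "moved_mirror (East c) = South (moved (East c) (prod.swap c))"

definition insert_sym :: "edge \<Rightarrow> tableau \<Rightarrow> tableau" where
  "insert_sym e T = insert_line (moved_mirror e) (insert_line e T)"

definition moved_sym :: "edge \<Rightarrow> cell \<Rightarrow> cell" where
  "moved_sym e c = moved (moved_mirror e) (moved e c)"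

definition lower_new_point :: "edge \<Rightarrow> cell" where
  "lower_new_point e = moved (moved_mirror e) (new_point e)"

definition upper_new_point :: "edge \<Rightarrow> cell" where
  "upper_new_point e = new_point (moved_mirror e)"


definition adjacent :: "(cell \<times> cell) set" where
  "adjacent = {((i, j), (i', j')).
     i = i' \<and> (j' = j + 1 \<or> j = j' + 1) \<or> j = j' \<and> (i' = i + 1 \<or> i = i' + 1)}"

definition is_ribbon :: "cell set \<Rightarrow> cell set \<Rightarrow> bool" where
  "is_ribbon D R \<longleftrightarrow>
     R \<inter> D = {} \<and> ferrers (D \<union> R) \<and>
     (\<forall>c \<in> R. \<forall>d \<in> R. (c, d) \<in> (adjacent \<inter> R \<times> R)\<^sup>*) \<and>
     (\<nexists>i j. {(i, j), (i, j + 1), (i + 1, j), (i + 1, j + 1)} \<subseteq> R)"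

definition ribbon_from_to :: "cell set \<Rightarrow> cell \<Rightarrow> cell \<Rightarrow> cell set \<Rightarrow> bool" where
  "ribbon_from_to D a b R \<longleftrightarrow> is_ribbon D R \<and> a \<in> R \<and> b \<in> R \<and>
     (\<forall>(i, j) \<in> R. i \<le> fst a \<and> snd a \<le> j \<and> fst b \<le> i \<and> j \<le> snd b)"

definition ribbon :: "cell set \<Rightarrow> cell \<Rightarrow> cell \<Rightarrow> cell set" where
  "ribbon D a b = (THE R. ribbon_from_to D a b R)"

definition right_of :: "cell \<Rightarrow> cell" where
  "right_of c = (fst c, snd c + 1)"

definition below :: "cell \<Rightarrow> cell" where
  "below c = (fst c + 1, snd c)"

definition add_empty :: "cell set \<Rightarrow> tableau \<Rightarrow> tableau" where
  "add_empty R T = (fst T \<union> R, snd T)"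

text \<open>
  If e is the bottom edge of the special cell p, then the cell below p is the new lower point
  itself, so the ribbon starting to the right of that point and ending there is empty.
\<close>

definition insertpoint_star :: "tableau \<Rightarrow> edge \<Rightarrow> int \<Rightarrow> tableau" where
  "insertpoint_star T e \<epsilon> =
     (let T' = insert_sym e T in
      if \<epsilon> = 1 then
        (if \<exists>p. is_star_special T p \<and> position e \<le> position (South p) then
           (let p = (THE p. is_star_special T p);
                R = (if e = South p then {}
                     else ribbon (fst T') (right_of (lower_new_point e)) (below (moved_sym e p)))
            in add_empty (R \<union> prod.swap ` R) T')
         else T')
      else
        add_empty (ribbon (fst T') (right_of (lower_new_point e)) (below (upper_new_point e))) T')"

end

(*
  The lower edges of a symmetric tableau correspond to
  its columns: if column c has height k, inserting at the edge of c means inserting a row and a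
  column of index k that both end at the new index of c. The result is a symmetric tableau with a
  pointed corner a below the diagonal, and (tableau, edge) can be read off from (tableau, corner).

  The second step adds to a tableau with marked corner a = (u, l) the part R of its outer rim
  between a and a second point b, together with the mirror image of R; here b is the *-special point
  (which is a itself if nothing has to be added) for sign 1 and the mirror image of a for sign -1.
  Afterwards a is the *-special point, R is the part of the inner rim between a and b, and b is the
  first point met when walking along the inner rim from a to the Northeast; so a, b and then the
  original tableau are determined by the result.
*)
theory Submission imports Defs begin

section \<open>Symmetric tableaux and ribbons\<close>

text \<open>Rule (2) refers to the special point before the insertion, whereas the second step sees
  only the tableau after it. The steps separate because the special point after the insertion is the
  new corner itself when \<open>e\<close> is the bottom edge of the old special point or lies
  Northeast of it, or when there is no old one, and is the old special point, moved, otherwise. So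
  for sign 1 every case fills from the corner to the special point of the already enlarged tableau.

  The sign is visible in the result: the second end of the ribbon lies below the diagonal for sign 1
  and above it for sign -1. The kind of the edge is visible in the corner: a non-root point has a
  point above it or to its left, but not both, and this tells whether the row or the column through
  the corner was inserted at \<open>e\<close>.\<close>

definition down_closed :: "cell set \<Rightarrow> bool" where
  "down_closed D \<longleftrightarrow> (\<forall>i j i' j'. (i, j) \<in> D \<longrightarrow> i' \<le> i \<longrightarrow> j' \<le> j \<longrightarrow> (i', j') \<in> D)"

lemma down_closedD:
  "down_closed D \<Longrightarrow> (i, j) \<in> D \<Longrightarrow> i' \<le> i \<Longrightarrow> j' \<le> j \<Longrightarrow> (i', j') \<in> D"
  unfolding down_closed_def by blast

text \<open>A downward closed set meets each row in an initial segment, so the number of cells in a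
  row serves as its length.\<close>

lemma ferrers_iff: "ferrers D \<longleftrightarrow> finite D \<and> down_closed D"
proof
  assume "ferrers D"
  then show "finite D \<and> down_closed D"
    unfolding ferrers_def down_closed_def antimono_def
    by (auto intro: less_le_trans le_less_trans)
next
  assume D: "finite D \<and> down_closed D"
  define len where "len i = card {j. (i, j) \<in> D}" for i
  have fin: "finite {j. (i, j) \<in> D}" for i
  proof -
    have "{j. (i, j) \<in> D} \<subseteq> snd ` D" by force
    then show ?thesis using D finite_subset by blast
  qed
  have "antimono len"
    unfolding antimono_def len_def
    using D fin by (auto intro!: card_mono dest: down_closedD)
  moreover have "(i, j) \<in> D \<longleftrightarrow> j < len i" for i j
  proof
    assume "(i, j) \<in> D"
    then have "{..j} \<subseteq> {j. (i, j) \<in> D}" using D by (auto dest: down_closedD)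
    then have "card {..j} \<le> len i" unfolding len_def using fin card_mono by blast
    then show "j < len i" by simp
  next
    assume less: "j < len i"
    show "(i, j) \<in> D"
    proof (rule ccontr)
      assume "(i, j) \<notin> D"
      then have "{j. (i, j) \<in> D} \<subseteq> {..<j}"
        using D by (auto intro: ccontr dest: down_closedD[of D i _ i j])
      then have "len i \<le> card {..<j}" unfolding len_def by (intro card_mono) auto
      then show False using less by simp
    qed
  qed
  ultimately show "ferrers D"
    unfolding ferrers_def using D by (auto intro!: exI[of _ len])
qed

section \<open>Symmetric tableaux as a locale\<close>

locale sym_tableau =
  fixes D P :: "cell set"
  assumes fin: "finite D"
    and down: "(i, j) \<in> D \<Longrightarrow> i' \<le> i \<Longrightarrow> j' \<le> j \<Longrightarrow> (i', j') \<in> D"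
    and symD: "(i, j) \<in> D \<Longrightarrow> (j, i) \<in> D"
    and symP: "(i, j) \<in> P \<Longrightarrow> (j, i) \<in> P"
    and sub: "(i, j) \<in> P \<Longrightarrow> (i, j) \<in> D"
    and root: "(0, 0) \<in> P"
    and tree: "(i, j) \<in> P \<Longrightarrow> (i, j) \<noteq> (0, 0) \<Longrightarrow>
      (\<exists>i' < i. (i', j) \<in> P) \<noteq> (\<exists>j' < j. (i, j') \<in> P)"
    and row: "(i, j) \<in> D \<Longrightarrow> \<exists>j'. (i, j') \<in> P"

lemma swap_image_eq_iff: "prod.swap ` A = A \<longleftrightarrow> (\<forall>i j. (i, j) \<in> A \<longrightarrow> (j, i) \<in> A)"
proof
  assume "\<forall>i j. (i, j) \<in> A \<longrightarrow> (j, i) \<in> A"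
  then show "prod.swap ` A = A" by auto
qed (metis pair_in_swap_image)

lemma sym_tableaux_iff:
  "(D, P) \<in> sym_tableaux m \<longleftrightarrow> sym_tableau D P \<and> card P = m"
proof -
  have "tree_like (D, P) \<and> symmetric (D, P) \<longleftrightarrow> sym_tableau D P"
  proof
    assume T: "tree_like (D, P) \<and> symmetric (D, P)"
    show "sym_tableau D P"
      using T unfolding tree_like_def symmetric_def ferrers_iff
      by unfold_locales (auto simp: swap_image_eq_iff dest: down_closedD)
  next
    assume "sym_tableau D P"
    then interpret sym_tableau D P .
    have "ferrers D" unfolding ferrers_iff down_closed_def using fin down by blast
    moreover have "symmetric (D, P)"
      unfolding symmetric_def swap_image_eq_iff using symD symP by simp
    moreover have "\<exists>i'. (i', j) \<in> P" if "(i, j) \<in> D" for i j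
      using row[OF symD[OF that]] symP by blast
    moreover have "\<forall>(i, j) \<in> P. (i, j) \<noteq> (0, 0) \<longrightarrow>
        ((\<exists>i' < i. (i', j) \<in> P) \<noteq> (\<exists>j' < j. (i, j') \<in> P))"
      using tree by blast
    moreover have "P \<subseteq> D" using sub by auto
    ultimately show "tree_like (D, P) \<and> symmetric (D, P)"
      unfolding tree_like_def case_prod_conv using root row by blast
  qed
  then show ?thesis unfolding sym_tableaux_def size_tableau_def by auto
qed

text \<open>The bounds on i and j are strict from below, so i - 1 and j - 1 do not truncate.\<close>

definition rim_between :: "cell set \<Rightarrow> cell \<Rightarrow> cell \<Rightarrow> cell set" where
  "rim_between D a b = {(i, j). (i, j) \<notin> D \<and> (i - 1, j - 1) \<in> D \<and>
     fst b < i \<and> i \<le> fst a \<and> snd a < j \<and> j \<le> snd b}"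

lemma rim_between_self: "rim_between D a a = {}"
  unfolding rim_between_def by auto

text \<open>This is the usual rim of a partition, cut to a box. The row of \<open>b\<close> and the
  column of \<open>a\<close> are left out, so neither end belongs to it.\<close>

definition inner_rim_between :: "cell set \<Rightarrow> cell \<Rightarrow> cell \<Rightarrow> cell set" where
  "inner_rim_between D a b = {(i, j). (i, j) \<in> D \<and> (i + 1, j + 1) \<notin> D \<and>
     fst b < i \<and> i \<le> fst a \<and> snd a < j \<and> j \<le> snd b}"

text \<open>A cell Northwest of a rim cell and outside \<open>D\<close> cannot leave the box: in the
  row of \<open>(r, s)\<close> or higher it would lie Northwest of \<open>(r, s)\<close>, and in the
  column of \<open>(u, l)\<close> or further left it would lie Northwest of
  \<open>(u, l)\<close>.\<close>

lemma down_closed_Un_rim: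
  assumes D: "down_closed D" and a: "(u, l) \<in> D" and b: "(r, s) \<in> D"
  shows "down_closed (D \<union> rim_between D (u, l) (r, s))"
  unfolding down_closed_def
proof (intro allI impI)
  fix i j i' j'
  assume ij: "(i, j) \<in> D \<union> rim_between D (u, l) (r, s)" and le: "i' \<le> i" "j' \<le> j"
  show "(i', j') \<in> D \<union> rim_between D (u, l) (r, s)"
  proof (cases "(i', j') \<in> D")
    case False
    then have "(i, j) \<notin> D" using D le down_closedD by blast
    then have R: "(i - 1, j - 1) \<in> D" "r < i" "i \<le> u" "l < j" "j \<le> s"
      using ij unfolding rim_between_def by auto
    have "r < i'" using False R(5) le(2) down_closedD[OF D b, of i' j'] by linarith
    moreover have "l < j'" using False R(3) le(1) down_closedD[OF D a, of i' j'] by linarith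
    moreover have "(i' - 1, j' - 1) \<in> D" using down_closedD[OF D R(1), of "i' - 1" "j' - 1"] le by simp
    ultimately show ?thesis using False R le unfolding rim_between_def by auto
  qed simp
qed

text \<open>A discrete intermediate value argument: the content, column minus row, changes by one at
  each step between adjacent cells.\<close>

lemma content_path:
  assumes "(x, y) \<in> (adjacent \<inter> R \<times> R)\<^sup>*" "x \<in> R"
    and "int (snd x) - int (fst x) \<le> t" "t \<le> int (snd y) - int (fst y)"
  shows "\<exists>z \<in> R. int (snd z) - int (fst z) = t"
  using assms
proof (induction rule: rtrancl_induct)
  case (step y z)
  have yz: "(y, z) \<in> adjacent" "y \<in> R" "z \<in> R" using step.hyps(2) by auto
  then have "int (snd z) - int (fst z) \<le> int (snd y) - int (fst y) + 1"
    unfolding adjacent_def by auto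
  then show ?case using step.IH step.prems yz(3)
    by (cases "t \<le> int (snd y) - int (fst y)") (auto intro: bexI[of _ z])
qed auto

text \<open>Every diagonal meets the rim at most once, and a connected set meets every diagonal between
  those of its ends.\<close>

lemma ribbon_from_to_unique:
  assumes D: "down_closed D"
    and R: "ribbon_from_to D (u, l + 1) (r + 1, s) R"
  shows "R = rim_between D (u, l) (r, s)"
proof -
  have R1: "R \<inter> D = {}" "down_closed (D \<union> R)" "(u, l + 1) \<in> R" "(r + 1, s) \<in> R"
    and path: "\<And>c d. c \<in> R \<Longrightarrow> d \<in> R \<Longrightarrow> (c, d) \<in> (adjacent \<inter> R \<times> R)\<^sup>*"
    and sq: "\<And>i j. \<not> {(i, j), (i, j + 1), (i + 1, j), (i + 1, j + 1)} \<subseteq> R"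
    and box: "\<And>i j. (i, j) \<in> R \<Longrightarrow> r < i \<and> i \<le> u \<and> l < j \<and> j \<le> s"
    using R unfolding ribbon_from_to_def is_ribbon_def ferrers_iff by auto
  have sub: "R \<subseteq> rim_between D (u, l) (r, s)"
  proof clarify
    fix i j assume ij: "(i, j) \<in> R"
    obtain i0 j0 where ij0: "i = i0 + 1" "j = j0 + 1"
      using box[OF ij] by (metis Suc_eq_plus1 less_imp_Suc_add)
    \<comment> \<open>Otherwise closure of \<open>D \<union> R\<close> would put the whole 2 by 2
      square with Southeast cell \<open>(i, j)\<close> into \<open>R\<close>.\<close>
    have "(i0, j0) \<in> D"
    proof (rule ccontr)
      assume n: "(i0, j0) \<notin> D"
      have "(i0, j0) \<in> D \<union> R" "(i0 + 1, j0) \<in> D \<union> R" "(i0, j0 + 1) \<in> D \<union> R"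
        using down_closedD[OF R1(2), of i j] ij ij0 by auto
      moreover have "(i0 + 1, j0) \<notin> D" "(i0, j0 + 1) \<notin> D"
        using n down_closedD[OF D] by (metis le_add1 order_refl)+
      ultimately show False using n sq[of i0 j0] ij ij0 by auto
    qed
    then show "(i, j) \<in> rim_between D (u, l) (r, s)"
      using box[OF ij] R1(1) ij ij0 unfolding rim_between_def by auto
  qed
  have "rim_between D (u, l) (r, s) \<subseteq> R"
  proof clarify
    fix i j assume ij: "(i, j) \<in> rim_between D (u, l) (r, s)"
    then have b: "(i, j) \<notin> D" "(i - 1, j - 1) \<in> D" "r < i" "i \<le> u" "l < j" "j \<le> s"
      unfolding rim_between_def by auto
    have "\<exists>z \<in> R. int (snd z) - int (fst z) = int j - int i"
      by (rule content_path[OF path[OF R1(3,4)] R1(3)]) (use b in auto)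
    then obtain i' j' where z: "(i', j') \<in> R" "int j' - int i' = int j - int i" by auto
    then have b': "(i', j') \<notin> D" "(i' - 1, j' - 1) \<in> D" "r < i'" "l < j'"
      using sub unfolding rim_between_def by auto
    have "\<not> i < i'" using down_closedD[OF D b'(2), of i j] b z(2) by force
    moreover have "\<not> i' < i" using down_closedD[OF D b(2), of i' j'] b' z(2) by force
    ultimately show "(i, j) \<in> R" using z by force
  qed
  with sub show ?thesis by blast
qed

text \<open>Walking left if the left neighbour is outside \<open>D\<close>, and down otherwise,
  stays on the rim until its Southwest end is reached. The induction measure is the content shifted
  by \<open>u\<close>, which drops by one per step.\<close>

lemma rim_connected:
  assumes D: "down_closed D" and a: "(u, l) \<in> D" "(u, l + 1) \<notin> D"
    and R: "R = rim_between D (u, l) (r, s)"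
    and c: "(i, j) \<in> R"
  shows "((i, j), (u, l + 1)) \<in> (adjacent \<inter> R \<times> R)\<^sup>*"
  using c
proof (induction "j + (u - i)" arbitrary: i j rule: less_induct)
  case less
  have b: "(i, j) \<notin> D" "(i - 1, j - 1) \<in> D" "r < i" "i \<le> u" "l < j" "j \<le> s"
    using less.prems unfolding R rim_between_def by auto
  show ?case
  proof (cases "(i, j) = (u, l + 1)")
    case False
    have "(i, j - 1) \<in> R \<and> l < j - 1 \<or> (i + 1, j) \<in> R \<and> i < u"
    proof (cases "(i, j - 1) \<in> D")
      case True
      have "i \<noteq> u" using True False a(2) b down_closedD[OF D True, of u "l + 1"] by auto
      moreover have "(i + 1, j) \<notin> D" using b(1) down_closedD[OF D] by (metis le_add1 order_refl)
      ultimately show ?thesis using True b unfolding R rim_between_def by auto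
    next
      case n: False
      have "j - 1 \<noteq> l" using n down_closedD[OF D a(1), of i "j - 1"] b by auto
      moreover have "(i - 1, j - 1 - 1) \<in> D" using down_closedD[OF D b(2)] by simp
      ultimately show ?thesis using n b unfolding R rim_between_def by auto
    qed
    then show ?thesis
    proof
      assume h: "(i, j - 1) \<in> R \<and> l < j - 1"
      then have "((i, j), (i, j - 1)) \<in> adjacent \<inter> R \<times> R"
        using less.prems unfolding adjacent_def by auto
      then show ?thesis using less.hyps[of "j - 1" i] h b
        by (auto intro: converse_rtrancl_into_rtrancl)
    next
      assume h: "(i + 1, j) \<in> R \<and> i < u"
      then have "((i, j), (i + 1, j)) \<in> adjacent \<inter> R \<times> R"
        using less.prems unfolding adjacent_def by auto
      then show ?thesis using less.hyps[of j "i + 1"] h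
        by (auto intro: converse_rtrancl_into_rtrancl)
    qed
  qed simp
qed

text \<open>The strict inequalities make both prescribed end cells rim cells. For
  \<open>(u, l) = (r, s)\<close> these cells would violate their own bounding box and
  \<open>THE\<close> would have no witness.\<close>

lemma ribbon_eq:
  assumes D: "finite D" "down_closed D"
    and a: "(u, l) \<in> D" "(u, l + 1) \<notin> D" and b: "(r, s) \<in> D" "(r + 1, s) \<notin> D"
    and ab: "r < u" "l < s"
  shows "ribbon D (u, l + 1) (r + 1, s) = rim_between D (u, l) (r, s)"
proof -
  let ?R = "rim_between D (u, l) (r, s)"
  let ?A = "adjacent \<inter> ?R \<times> ?R"
  have "finite ?R"
    by (rule finite_subset[of _ "{..u} \<times> {..s}"]) (auto simp: rim_between_def)
  then have fer: "ferrers (D \<union> ?R)"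
    unfolding ferrers_iff using D down_closed_Un_rim a b by auto
  have "sym ?A" unfolding sym_def adjacent_def by auto
  then have "sym (?A\<^sup>*)" by (rule sym_rtrancl)
  then have conn: "(c, d) \<in> ?A\<^sup>*" if "c \<in> ?R" "d \<in> ?R" for c d
  proof -
    have "(e, (u, l + 1)) \<in> ?A\<^sup>*" if "e \<in> ?R" for e
      using rim_connected[OF D(2) a refl, where i = "fst e" and j = "snd e" and r = r and s = s] that
      by simp
    then show ?thesis
      using that symD[OF \<open>sym (?A\<^sup>*)\<close>, of d "(u, l + 1)"] rtrancl_trans[of c _ ?A d] by blast
  qed
  have sq: "\<not> {(i, j), (i, j + 1), (i + 1, j), (i + 1, j + 1)} \<subseteq> ?R" for i j
    unfolding rim_between_def by auto
  have "(u - 1, l) \<in> D" "(r, s - 1) \<in> D" using down_closedD[OF D(2)] a b by auto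
  then have ends: "(u, l + 1) \<in> ?R" "(r + 1, s) \<in> ?R"
    using a b ab unfolding rim_between_def by auto
  have "ribbon_from_to D (u, l + 1) (r + 1, s) ?R"
    unfolding ribbon_from_to_def is_ribbon_def
    using fer conn sq ends by (auto simp: rim_between_def)
  then show ?thesis
    unfolding ribbon_def using ribbon_from_to_unique[OF D(2)] by (intro the_equality)
qed

section \<open>Adding and removing ribbons\<close>

definition lower_corners :: "tableau \<Rightarrow> cell set" where
  "lower_corners T = {(u, l) \<in> snd T. l < u \<and> (u + 1, l) \<notin> fst T \<and> (u, l + 1) \<notin> fst T}"

definition fill :: "cell \<Rightarrow> cell \<Rightarrow> tableau \<Rightarrow> tableau" where
  "fill a b T = (let R = rim_between (fst T) a b in add_empty (R \<union> prod.swap ` R) T)"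

text \<open>The walk along the inner rim enters the row of \<open>b\<close> from below, and
  \<open>below b \<in> E\<close> says that \<open>b\<close> is the cell of entry. Thus the row of
  \<open>b\<close> determines its column.\<close>

definition next_point :: "cell set \<Rightarrow> cell set \<Rightarrow> cell \<Rightarrow> cell \<Rightarrow> bool" where
  "next_point E P a b \<longleftrightarrow> b \<in> P \<and> fst b < fst a \<and> snd a < snd b \<and> below b \<in> E \<and>
     (fst b + 1, snd b + 1) \<notin> E \<and> P \<inter> inner_rim_between E a b = {}"

text \<open>Of two candidates in different rows, the lower one would be a point on the part of the
  rim that the other requires to be free of points. Within one row the column is forced.\<close>

lemma next_point_unique:
  assumes E: "down_closed E" and P: "P \<subseteq> E"
    and b: "next_point E P a b" "next_point E P a b'"
  shows "b = b'"
proof -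
  have *: "\<not> r' < r" if "next_point E P a (r, s)" "next_point E P a (r', s')" for r s r' s'
  proof
    assume r: "r' < r"
    have "s \<le> s'"
    proof (rule ccontr)
      assume "\<not> s \<le> s'"
      then have "(r' + 1, s' + 1) \<in> E"
        using down_closedD[OF E, of r s] that(1) P r unfolding next_point_def by auto
      then show False using that(2) unfolding next_point_def by simp
    qed
    then have "(r, s) \<in> inner_rim_between E a (r', s')"
      using that P r unfolding next_point_def inner_rim_between_def by auto
    then show False using that unfolding next_point_def by auto
  qed
  have **: "\<not> s < s'" if "next_point E P a (r, s)" "next_point E P a (r, s')" for r s s'
  proof
    assume "s < s'"
    then have "(r + 1, s + 1) \<in> E"
      using down_closedD[OF E, of "r + 1" s'] that(2) unfolding next_point_def below_def by auto
    then show False using that(1) unfolding next_point_def by simp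
  qed
  obtain r s r' s' where rs: "b = (r, s)" "b' = (r', s')" by fastforce
  then have "r = r'" using * b by (meson linorder_neqE_nat)
  then show ?thesis using ** b rs by (metis linorder_neqE_nat)
qed

context sym_tableau
begin

lemma down_closed: "down_closed D"
  unfolding down_closed_def using down by blast

lemma symD_iff: "(i, j) \<in> D \<longleftrightarrow> (j, i) \<in> D"
  using symD by blast

text \<open>By symmetry a diagonal point has a point above it exactly when it has one to its left,
  which the tree condition allows only for the root.\<close>

lemma diagonal_point: "(i, i) \<in> P \<Longrightarrow> i = 0"
  using tree[of i i] symP by blast

text \<open>Columns weakly shorten to the right, so a bottom point further right is also weakly
  higher, and comparing columns suffices.\<close>

lemma is_star_special_iff:
  "is_star_special (D, P) (u, l) \<longleftrightarrow> (u, l) \<in> P \<and> l < u \<and> (u + 1, l) \<notin> D \<and>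
     (\<forall>i j. (i, j) \<in> P \<longrightarrow> (i + 1, j) \<notin> D \<longrightarrow> j < i \<longrightarrow> j \<le> l)"
proof -
  have "u \<le> i" if "(u, l) \<in> P" "(i + 1, j) \<notin> D" "j \<le> l" for i j
    using down[OF sub[OF that(1)], of "i + 1" j] that by linarith
  then show ?thesis
    unfolding is_star_special_def lower_bottom_points_def by fastforce
qed

lemma is_star_special_unique:
  "is_star_special (D, P) p \<Longrightarrow> is_star_special (D, P) q \<Longrightarrow> p = q"
  unfolding is_star_special_def by (meson le_antisym prod_eqI)

lemma the_star_special: "is_star_special (D, P) p \<Longrightarrow> (THE q. is_star_special (D, P) q) = p"
  using is_star_special_unique by blast

lemma ex_star_special:
  assumes "(i, j) \<in> P" "(i + 1, j) \<notin> D" "j < i"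
  shows "\<exists>p. is_star_special (D, P) p"
proof -
  let ?B = "{(i, j) \<in> P. (i + 1, j) \<notin> D \<and> j < i}"
  have "finite P" using sub by (intro finite_subset[OF _ fin]) auto
  then have fin: "finite (snd ` ?B)" by (auto intro: finite_subset[of _ P])
  have "(i, j) \<in> ?B" using assms by simp
  then have "Max (snd ` ?B) \<in> snd ` ?B" using fin by (intro Max_in) auto
  then obtain u l where ul: "(u, l) \<in> ?B" "l = Max (snd ` ?B)" by auto
  have "j' \<le> l" if "(i', j') \<in> P" "(i' + 1, j') \<notin> D" "j' < i'" for i' j'
    unfolding ul(2) using that fin by (intro Max_ge) (auto simp: image_iff)
  then have "is_star_special (D, P) (u, l)" unfolding is_star_special_iff using ul(1) by auto
  then show ?thesis ..
qed

text \<open>A point in the lowest row is the bottom of its column. By symmetry it lies on or below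
  the diagonal, and on it only if the root is the only point.\<close>

lemma ex_star_special_of_card:
  assumes "card P > 1"
  shows "\<exists>p. is_star_special (D, P) p"
proof -
  let ?i = "Max (fst ` D)"
  have D: "(0, 0) \<in> D" "finite (fst ` D)" using root sub fin by auto
  then have "?i \<in> fst ` D" by (intro Max_in) auto
  then obtain j0 where j0: "(?i, j0) \<in> D" by force
  have max: "i \<le> ?i" if "(i, j) \<in> D" for i j using that D by (intro Max_ge) force+
  obtain j where j: "(?i, j) \<in> P" using row[OF j0] by blast
  have "j \<le> ?i" using max symD sub j by blast
  moreover have "j \<noteq> ?i"
  proof
    assume "j = ?i"
    then have "?i = 0" using j diagonal_point by simp
    then have "P \<subseteq> {(0, 0)}" using max sub symP by fastforce
    then have "card P \<le> card {(0 :: nat, 0 :: nat)}" by (intro card_mono) auto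
    then show False using assms by simp
  qed
  moreover have "(?i + 1, j) \<notin> D" using max by fastforce
  ultimately show ?thesis using j ex_star_special by force
qed

end

section \<open>Adding a ribbon and its mirror image\<close>

locale filling = sym_tableau +
  fixes u l r s :: nat
  assumes corner: "(u, l) \<in> P" "l < u" "(u + 1, l) \<notin> D" "(u, l + 1) \<notin> D"
    and target: "(r, s) = (l, u) \<or> is_star_special (D, P) (r, s)"
begin

abbreviation "R \<equiv> rim_between D (u, l) (r, s)"

abbreviation "E \<equiv> D \<union> R \<union> prod.swap ` R"

lemma target_cases: "r = l \<and> s = u \<or> s < r"
  using target unfolding is_star_special_iff by auto

lemma target_point: "(r, s) \<in> P" "(r + 1, s) \<notin> D"
  using target corner symP symD_iff[of "l + 1" u] unfolding is_star_special_iff by auto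

lemma target_bounds: "r \<le> u" "l \<le> s"
proof -
  show ls: "l \<le> s" using target corner unfolding is_star_special_iff by auto
  show "r \<le> u"
    using down[OF sub[OF target_point(1)], of "u + 1" l] ls corner(3) by linarith
qed

lemma target_strict:
  assumes "(r, s) \<noteq> (u, l)"
  shows "r < u" "l < s"
proof -
  have "\<not> (r = u \<and> l < s)"
    using down[OF sub[OF target_point(1)], of u "l + 1"] corner(4) by auto
  moreover have "\<not> (s = l \<and> r < u)"
    using down[OF sub[OF corner(1)], of "r + 1" l] target_point(2) by auto
  ultimately show "r < u" "l < s" using target_bounds assms by auto
qed

lemma E_iff: "(i, j) \<in> E \<longleftrightarrow> (i, j) \<in> D \<or> (i, j) \<in> R \<or> (j, i) \<in> R"
  by (metis Un_iff pair_in_swap_image)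

lemma R_iff:
  "(i, j) \<in> R \<longleftrightarrow> (i, j) \<notin> D \<and> (i - 1, j - 1) \<in> D \<and> r < i \<and> i \<le> u \<and> l < j \<and> j \<le> s"
  unfolding rim_between_def by auto

lemma R_swap: "(j, i) \<in> R \<Longrightarrow> (i, j) \<notin> D \<and> (i - 1, j - 1) \<in> D"
  unfolding R_iff using symD by blast

lemma R_box: "(i, j) \<in> R \<Longrightarrow> i \<le> u \<and> j \<le> u"
  unfolding R_iff using target_cases target_bounds by auto

lemma finite_E: "finite E"
proof -
  have "R \<subseteq> {..u} \<times> {..u}" using R_box by auto
  then have "finite R" using finite_subset by blast
  then show ?thesis using fin by auto
qed

lemma down_E: "(i, j) \<in> E \<Longrightarrow> i' \<le> i \<Longrightarrow> j' \<le> j \<Longrightarrow> (i', j') \<in> E"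
  using down_closedD[OF down_closed_Un_rim[OF down_closed sub[OF corner(1)]
      sub[OF target_point(1)]], of i j i' j']
    down_closedD[OF down_closed_Un_rim[OF down_closed sub[OF corner(1)]
      sub[OF target_point(1)]], of j i j' i'] symD
  unfolding E_iff by blast

lemma sym_tableau_E: "sym_tableau E P"
proof
  show "(i, j) \<in> E \<Longrightarrow> (j, i) \<in> E" for i j unfolding E_iff using symD by blast
  \<comment> \<open>No new row arises: the added cells lie in rows up to \<open>u\<close>, and these
    already meet \<open>D\<close> in column \<open>l\<close> and hence contain a point.\<close>
  have R_row: "(i, l) \<in> D" if "i \<le> u" for i using down sub corner(1) that by blast
  show "\<exists>j'. (i, j') \<in> P" if "(i, j) \<in> E" for i j
    using that R_box R_row row unfolding E_iff by blast
qed (use finite_E down_E sub root tree symP in auto)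

text \<open>The ribbon puts a cell under every bottom point of \<open>D\<close> that lies below the
  diagonal and to the right of the corner, so no competitor remains.\<close>

lemma star_special_E: "is_star_special (E, P) (u, l)"
proof -
  interpret E: sym_tableau E P by (rule sym_tableau_E)
  have "(u + 1, l) \<notin> E" using corner R_box[of "u + 1" l] R_box[of l "u + 1"] unfolding E_iff by auto
  moreover have "j \<le> l" if ij: "(i, j) \<in> P" "(i + 1, j) \<notin> E" "j < i" for i j
  proof (rule ccontr)
    assume j: "\<not> j \<le> l"
    have D: "(i + 1, j) \<notin> D" "(i + 1, j) \<notin> R" using ij(2) unfolding E_iff by auto
    have "i < u" using down[OF sub[OF ij(1)], of u "l + 1"] corner(4) j by linarith
    moreover have "(i, j - 1) \<in> D" using down sub ij(1) by (meson diff_le_self order_refl)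
    moreover have "r \<le> i \<and> j \<le> s"
      using target
    proof
      assume "(r, s) = (l, u)"
      then show ?thesis using j ij(3) \<open>i < u\<close> by auto
    next
      assume b: "is_star_special (D, P) (r, s)"
      then have js: "j \<le> s" using ij D(1) unfolding is_star_special_iff by auto
      moreover have "r \<le> i"
        using down[OF sub[OF target_point(1)], of "i + 1" j] js D(1) by linarith
      ultimately show ?thesis by simp
    qed
    ultimately have "(i + 1, j) \<in> R" using D(1) j unfolding R_iff by auto
    then show False using D(2) by simp
  qed
  ultimately show ?thesis unfolding E.is_star_special_iff using corner by auto
qed

text \<open>An added cell has no cell of \<open>E\<close> as its Southeast diagonal neighbour.
  Conversely, a cell of \<open>D\<close> in the box is not on the inner rim of \<open>E\<close>, as
  its Southeast diagonal neighbour lies in \<open>D\<close> or was added.\<close>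

lemma inner_rim_E: "inner_rim_between E (u, l) (r, s) = R"
proof -
  have "(i, j) \<in> inner_rim_between E (u, l) (r, s) \<longleftrightarrow> (i, j) \<in> R" for i j
  proof
    assume ij: "(i, j) \<in> R"
    then have n: "(i, j) \<notin> D" unfolding R_iff by blast
    then have "(i + 1, j + 1) \<notin> D" "(i + 1, j + 1) \<notin> R" "(j + 1, i + 1) \<notin> R"
      using down[of "i + 1" "j + 1" i j] R_iff[of "i + 1" "j + 1"] R_swap[of "j + 1" "i + 1"]
      by auto
    then have "(i + 1, j + 1) \<notin> E" unfolding E_iff by blast
    then show "(i, j) \<in> inner_rim_between E (u, l) (r, s)"
      using ij R_iff[of i j] unfolding inner_rim_between_def by simp
  next
    assume "(i, j) \<in> inner_rim_between E (u, l) (r, s)"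
    then have ij: "(i, j) \<in> E" "(i + 1, j + 1) \<notin> E" "r < i" "i \<le> u" "l < j" "j \<le> s"
      unfolding inner_rim_between_def by auto
    have "(i, j) \<notin> D"
    proof
      assume D: "(i, j) \<in> D"
      have "i \<noteq> u" using down[OF D, of u "l + 1"] corner(4) ij by auto
      moreover have "j \<noteq> s" using down[OF D, of "r + 1" s] target_point(2) ij by auto
      ultimately have "(i + 1, j + 1) \<in> D \<or> (i + 1, j + 1) \<in> R"
        using D ij R_iff[of "i + 1" "j + 1"] by auto
      then show False using ij(2) unfolding E_iff by blast
    qed
    then show "(i, j) \<in> R" using ij R_swap[of j i] R_iff[of i j] E_iff[of i j] by blast
  qed
  then show ?thesis by (intro set_eqI) (metis surj_pair)
qed

lemma E_minus_inner_rim: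
  "D = E - inner_rim_between E (u, l) (r, s) - prod.swap ` inner_rim_between E (u, l) (r, s)"
proof -
  have "(i, j) \<in> D \<longleftrightarrow> (i, j) \<in> E - R - prod.swap ` R" for i j
    using R_swap[of j i] R_iff[of i j] unfolding Diff_iff E_iff pair_in_swap_image by blast
  then show ?thesis unfolding inner_rim_E by (intro set_eqI) (metis surj_pair)
qed

text \<open>The cell to the right of the corner is the test for whether anything was added. If so,
  the inner rim up to \<open>(r, s)\<close> consists of added, hence empty, cells.\<close>

lemma below_target:
  assumes "(r, s) \<noteq> (u, l)"
  shows "(u, l + 1) \<in> E" "next_point E P (u, l) (r, s)"
proof -
  note strict = target_strict[OF assms]
  have "(u - 1, l) \<in> D" "(r, s - 1) \<in> D"
    using down sub corner(1) target_point(1) by (meson diff_le_self order_refl)+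
  then have R: "(u, l + 1) \<in> R" "(r + 1, s) \<in> R"
    using strict corner(4) target_point(2) unfolding R_iff by auto
  then show "(u, l + 1) \<in> E" unfolding E_iff by simp
  have "(r + 1, s + 1) \<notin> D" using target_point(2) down by (meson le_add1 order_refl)
  moreover have "(r + 1, s + 1) \<notin> R" "(s + 1, r + 1) \<notin> R"
    unfolding R_iff using target_cases by auto
  ultimately have "(r + 1, s + 1) \<notin> E" unfolding E_iff by blast
  moreover have "P \<inter> R = {}" using sub unfolding rim_between_def by auto
  ultimately show "next_point E P (u, l) (r, s)"
    unfolding next_point_def inner_rim_E below_def using strict target_point(1) R
    by (auto simp: E_iff)
qed

end

section \<open>Removing a ribbon and its mirror image\<close>

text \<open>The quantity s + (u - r) is the content s - r shifted by u, so that it is a natural number; it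
  orders the cells of the rim from Southwest to Northeast.\<close>

locale unfilling = sym_tableau E P for E P +
  fixes u l r s :: nat
  assumes special: "is_star_special (E, P) (u, l)"
    and right: "(u, l + 1) \<in> E"
    and next_candidate: "(r, s) \<in> P" "r < u" "l < s" "(r + 1, s + 1) \<notin> E"
    and first: "(i, j) \<in> P \<Longrightarrow> i < u \<Longrightarrow> l < j \<Longrightarrow> (i + 1, j + 1) \<notin> E \<Longrightarrow> s + (u - r) \<le> j + (u - i)"
begin

abbreviation "I \<equiv> inner_rim_between E (u, l) (r, s)"

abbreviation "D \<equiv> E - I - prod.swap ` I"

lemma corner: "(u, l) \<in> P" "l < u" "(u + 1, l) \<notin> E"
  and special_max: "(i, j) \<in> P \<Longrightarrow> (i + 1, j) \<notin> E \<Longrightarrow> j < i \<Longrightarrow> j \<le> l"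
  using special unfolding is_star_special_iff by auto

text \<open>The first candidate is the mirror image of the special point or lies below the diagonal: if
  it lay above the diagonal, its mirror image would be an earlier candidate.\<close>

lemma target_cases: "(r, s) = (l, u) \<or> s < r"
proof (rule ccontr)
  assume n: "\<not> ((r, s) = (l, u) \<or> s < r)"
  have mirror: "(l + 1, u) \<in> E" "(l, u + 1) \<notin> E" "(l, u) \<in> P"
    using right corner symD_iff symP by auto
  have "(l + 1, u + 1) \<notin> E" using down[of "l + 1" "u + 1" l "u + 1"] mirror(2) by auto
  then have content: "s + (u - r) \<le> u + (u - l)" using first[OF mirror(3)] corner(2) by auto
  have "r \<noteq> s" using diagonal_point next_candidate(1,3) by auto
  then have rs: "r < s" using n by auto
  \<comment> \<open>Otherwise the content bound puts \<open>(r + 1, s + 1)\<close> Northwest of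
    \<open>(l + 1, u)\<close> or \<open>(l, u)\<close>, and \<open>(r, s)\<close> would not be on
    the rim.\<close>
  have lr: "l < r"
  proof (rule ccontr)
    assume "\<not> l < r"
    then have "(r + 1, s + 1) \<in> E"
      using n content next_candidate(2) corner(2)
        down[OF mirror(1), of "r + 1" "s + 1"] down[OF sub[OF mirror(3)], of "r + 1" "s + 1"]
      by (cases "r = l") auto
    then show False using next_candidate(4) by simp
  qed
  \<comment> \<open>The mirror image of a point in column \<open>u\<close> would be a bottom point
    in row \<open>u\<close>, below the diagonal and to the right of the special point.\<close>
  have su: "s < u"
  proof (rule ccontr)
    assume "\<not> s < u"
    then have "s = u"
      using down[OF sub[OF next_candidate(1)], of l "u + 1"] mirror(2) lr by linarith
    then have "(u, r) \<in> P" using next_candidate(1) symP by simp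
    moreover have "(u + 1, r) \<notin> E" using down[of "u + 1" r "u + 1" l] corner(3) lr by auto
    ultimately show False using special_max rs \<open>s = u\<close> lr by fastforce
  qed
  have "s + (u - r) \<le> r + (u - s)"
    using first[OF symP[OF next_candidate(1)] su lr] next_candidate(4) symD by blast
  then show False using rs su by linarith
qed

lemma below_target: "(r + 1, s) \<in> E"
  using target_cases
proof
  assume "(r, s) = (l, u)"
  then show ?thesis using right symD by auto
next
  assume "s < r"
  then show ?thesis using special_max[OF next_candidate(1)] next_candidate(3) by auto
qed

lemma I_iff: "(i, j) \<in> I \<longleftrightarrow>
    (i, j) \<in> E \<and> (i + 1, j + 1) \<notin> E \<and> r < i \<and> i \<le> u \<and> l < j \<and> j \<le> s"
  unfolding inner_rim_between_def by simp

lemma I_swap: "(j, i) \<in> I \<Longrightarrow> (i, j) \<in> E \<and> (i + 1, j + 1) \<notin> E"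
  unfolding I_iff using symD by blast

lemma D_iff: "(i, j) \<in> D \<longleftrightarrow> (i, j) \<in> E \<and> (i, j) \<notin> I \<and> (j, i) \<notin> I"
  unfolding Diff_iff pair_in_swap_image by blast

text \<open>Cells of \<open>I\<close> come before \<open>(r, s)\<close> on the rim, so a point among
  them above row \<open>u\<close> contradicts \<open>first\<close>. A point in row \<open>u\<close>
  would be a bottom point to the right of the special one.\<close>

lemma P_disjoint_I:
  assumes "(i, j) \<in> P"
  shows "(i, j) \<notin> I"
proof
  assume I: "(i, j) \<in> I"
  have su: "s \<le> u" using target_cases next_candidate(2) by auto
  show False
  proof (cases "i < u")
    case True
    then show False using first[OF assms True] I unfolding I_iff by auto
  next
    case False
    then have i: "i = u" "l < j" "j \<le> s" using I unfolding I_iff by auto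
    have "(u + 1, j) \<notin> E" using down[of "u + 1" j "u + 1" l] corner(3) i by auto
    moreover have "j \<noteq> u" using diagonal_point assms i corner(2) by auto
    ultimately show False using special_max[of u j] assms i su by simp
  qed
qed

text \<open>\<open>I\<close> is closed under going Southeast within \<open>E\<close>, so its removal
  leaves a downward closed set.\<close>

lemma down_I:
  assumes ij: "(i, j) \<in> E" and le: "i' \<le> i" "j' \<le> j" and I: "(i', j') \<in> I"
  shows "(i, j) \<in> I"
proof -
  have I': "(i' + 1, j' + 1) \<notin> E" "r < i'" "i' \<le> u" "l < j'" "j' \<le> s"
    using I unfolding I_iff by auto
  have "(i + 1, j + 1) \<notin> E" using down[of "i + 1" "j + 1"] I'(1) le by auto
  moreover have "i \<le> u" using down[OF ij, of "u + 1" l] corner(3) I' le by linarith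
  moreover have "j \<le> s" using down[OF ij, of "r + 1" "s + 1"] next_candidate(4) I' le by linarith
  ultimately show ?thesis using ij le I' unfolding I_iff by auto
qed

lemma sym_tableau_D: "sym_tableau D P"
proof
  show "(i', j') \<in> D" if "(i, j) \<in> D" "i' \<le> i" "j' \<le> j" for i j i' j'
    using that down[of i j i' j'] down_I[of i j i' j'] down_I[of j i j' i'] symD
    unfolding D_iff by blast
  show "(i, j) \<in> D \<Longrightarrow> (j, i) \<in> D" for i j unfolding D_iff using symD by blast
  show "(i, j) \<in> P \<Longrightarrow> (i, j) \<in> D" for i j
    unfolding D_iff using P_disjoint_I sub symP by blast
  show "(i, j) \<in> D \<Longrightarrow> \<exists>j'. (i, j') \<in> P" for i j using row by blast
qed (use fin root tree symP in auto)

text \<open>The removal frees the right side of the corner and, if \<open>(r, s)\<close> lies below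
  the diagonal, its bottom side. Below the diagonal it takes nothing from columns beyond
  \<open>s\<close>, so no bottom point further right arises.\<close>

lemma filling: "filling D P u l r s"
proof -
  interpret D: sym_tableau D P by (rule sym_tableau_D)
  have "(u, l + 1) \<in> I"
    using right next_candidate down[of "u + 1" "l + 1 + 1" "u + 1" l] corner(3) unfolding I_iff by auto
  then have "(u, l + 1) \<notin> D" unfolding D_iff by blast
  moreover have "(r, s) = (l, u) \<or> is_star_special (D, P) (r, s)"
    using target_cases
  proof
    assume sr: "s < r"
    have "(r + 1 + 1, s + 1) \<notin> E" using down[of "r + 1 + 1" "s + 1"] next_candidate(4) by auto
    then have "(r + 1, s) \<in> I" using below_target next_candidate unfolding I_iff by auto
    then have "(r + 1, s) \<notin> D" unfolding D_iff by blast
    moreover have "j \<le> s" if ij: "(i, j) \<in> P" "(i + 1, j) \<notin> D" "j < i" for i j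
    proof (rule ccontr)
      assume js: "\<not> j \<le> s"
      then have "(i + 1, j) \<in> E" using special_max[OF ij(1)] ij(3) next_candidate(3) by auto
      then have "(i + 1, j) \<in> I \<or> (j, i + 1) \<in> I" using ij(2) unfolding D_iff by blast
      then show False using js ij(3) sr unfolding I_iff by auto
    qed
    ultimately show ?thesis unfolding D.is_star_special_iff using next_candidate(1) sr by auto
  qed simp
  ultimately show ?thesis using corner by unfold_locales auto
qed

lemma rim_D: "rim_between D (u, l) (r, s) = I"
proof -
  interpret F: filling D P u l r s by (rule filling)
  have "(i, j) \<in> F.R \<longleftrightarrow> (i, j) \<in> I" for i j
  proof
    assume "(i, j) \<in> F.R"
    then have R: "(i, j) \<notin> D" "(i - 1, j - 1) \<in> D" "r < i" "i \<le> u" "l < j" "j \<le> s"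
      unfolding F.R_iff by auto
    have "(i, j) \<in> E"
    proof (rule ccontr)
      assume n: "(i, j) \<notin> E"
      have "(i - 1, j - 1) \<notin> I" "(i - 1, j - 1) \<in> E" using R(2) unfolding D_iff by auto
      \<comment> \<open>A neighbour inside the box would have been removed. So \<open>(i, j)\<close>
        lies in the top row or left column of the box, which \<open>below_target\<close> and
        \<open>right\<close> place inside \<open>E\<close>.\<close>
      then have "i - 1 \<le> r \<or> j - 1 \<le> l" using n R unfolding I_iff by auto
      then have "i \<le> r + 1 \<or> j \<le> l + 1" by linarith
      then show False
        using n R(4,6) down[OF below_target, of i j] down[OF right, of i j] by blast
    qed
    then show "(i, j) \<in> I" using R I_swap[of j i] unfolding D_iff I_iff by blast
  next
    assume I: "(i, j) \<in> I"
    then have ij: "r < i" "l < j" "(i, j) \<in> E" unfolding I_iff by auto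
    have "(i - 1, j - 1) \<notin> I" "(j - 1, i - 1) \<notin> I"
      using ij I_swap[of "j - 1" "i - 1"] I_iff[of "i - 1" "j - 1"] by auto
    moreover have "(i - 1, j - 1) \<in> E" using down[OF ij(3)] by simp
    ultimately have "(i - 1, j - 1) \<in> D" unfolding D_iff by blast
    moreover have "(i, j) \<notin> D" using I unfolding D_iff by blast
    ultimately show "(i, j) \<in> F.R" using I unfolding F.R_iff I_iff by blast
  qed
  then show ?thesis by (intro set_eqI) (metis surj_pair)
qed

lemma E_eq: "E = D \<union> rim_between D (u, l) (r, s) \<union> prod.swap ` rim_between D (u, l) (r, s)"
proof -
  have "(i, j) \<in> E \<longleftrightarrow> (i, j) \<in> D \<union> I \<union> prod.swap ` I" for i j
    unfolding Un_iff D_iff pair_in_swap_image using I_swap[of j i] I_iff[of i j] by blast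
  then show ?thesis unfolding rim_D by (intro set_eqI) (metis surj_pair)
qed

end

text \<open>The mirror image of the special point is a candidate, so one of least content
  exists.\<close>

lemma (in sym_tableau) ex_unfilling:
  assumes special: "is_star_special (D, P) (u, l)" and right: "(u, l + 1) \<in> D"
  shows "\<exists>r s. unfilling D P u l r s"
proof -
  let ?C = "\<lambda>(i, j). (i, j) \<in> P \<and> i < u \<and> l < j \<and> (i + 1, j + 1) \<notin> D"
  have ul: "(u, l) \<in> P" "l < u" "(u + 1, l) \<notin> D"
    using special unfolding is_star_special_iff by auto
  then have "(l + 1, u + 1) \<notin> D" using down[of "u + 1" "l + 1" "u + 1" l] symD by auto
  then have "?C (l, u)" using ul symP by simp
  then obtain c where c: "?C c" "\<forall>d. ?C d \<longrightarrow> snd c + (u - fst c) \<le> snd d + (u - fst d)"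
    using ex_has_least_nat[of ?C "(l, u)" "\<lambda>d. snd d + (u - fst d)"] by blast
  obtain r s where "c = (r, s)" by fastforce
  then have "unfilling D P u l r s"
    using c special right by unfold_locales auto
  then show ?thesis by blast
qed

section \<open>The second step as a bijection\<close>

definition star_fill :: "tableau \<times> cell \<times> int \<Rightarrow> tableau" where
  "star_fill = (\<lambda>(T, a, \<epsilon>).
     fill a (if \<epsilon> = 1 then (THE p. is_star_special T p) else prod.swap a) T)"

lemma fill_eq:
  "fill a b (D, P) = (D \<union> rim_between D a b \<union> prod.swap ` rim_between D a b, P)"
  unfolding fill_def add_empty_def Let_def by (simp add: Un_assoc)

lemma (in sym_tableau) ex_filling:
  assumes "(u, l) \<in> lower_corners (D, P)" and \<epsilon>: "\<epsilon> \<in> {1, -1}"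
  shows "\<exists>r s. filling D P u l r s \<and> (\<epsilon> = 1 \<longleftrightarrow> s < r) \<and>
    star_fill ((D, P), (u, l), \<epsilon>) = fill (u, l) (r, s) (D, P)"
proof -
  have ul: "(u, l) \<in> P" "l < u" "(u + 1, l) \<notin> D" "(u, l + 1) \<notin> D"
    using assms unfolding lower_corners_def by auto
  show ?thesis
  proof (cases "\<epsilon> = 1")
    case True
    obtain r s where rs: "is_star_special (D, P) (r, s)" using ex_star_special[OF ul(1,3,2)] by auto
    moreover have "s < r" using rs unfolding is_star_special_iff by simp
    moreover have "filling D P u l r s" using ul rs by unfold_locales auto
    ultimately show ?thesis using True the_star_special unfolding star_fill_def by force
  next
    case False
    have "filling D P u l l u" using ul by unfold_locales auto
    then show ?thesis using False ul unfolding star_fill_def by force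
  qed
qed

text \<open>The bound on \<open>m\<close> excludes the tableau of size 1, which has no special point
  from which an inverse could start.\<close>

lemma bij_betw_star_fill:
  assumes m: "m > 1"
  shows "bij_betw star_fill
    {(T, a, \<epsilon>). T \<in> sym_tableaux m \<and> a \<in> lower_corners T \<and> \<epsilon> \<in> {1, -1}} (sym_tableaux m)"
    (is "bij_betw _ ?X _")
proof -
  have repr: "\<exists>D P u l r s. x = ((D, P), (u, l), \<epsilon>) \<and> filling D P u l r s \<and> card P = m \<and>
      (\<epsilon> = 1 \<longleftrightarrow> s < r) \<and> star_fill x = fill (u, l) (r, s) (D, P)"
    if x: "x \<in> ?X" "snd (snd x) = \<epsilon>" for x \<epsilon>
  proof -
    obtain D P u l where DP: "x = ((D, P), (u, l), \<epsilon>)" using x(2) by (metis prod.collapse)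
    have T: "sym_tableau D P" "card P = m" using x DP by (auto simp: sym_tableaux_iff)
    interpret sym_tableau D P by (rule T(1))
    show ?thesis using ex_filling[of u l \<epsilon>] x DP T(2) by auto
  qed
  show ?thesis
    unfolding bij_betw_def
  proof (intro conjI inj_onI equalityI image_subsetI subsetI)
    fix x y assume x: "x \<in> ?X" and y: "y \<in> ?X" and eq: "star_fill x = star_fill y"
    obtain D P u l r s where F: "x = ((D, P), (u, l), snd (snd x))" "filling D P u l r s"
        "snd (snd x) = 1 \<longleftrightarrow> s < r" "star_fill x = fill (u, l) (r, s) (D, P)"
      using repr[OF x refl] by blast
    obtain D' P' u' l' r' s' where F': "y = ((D', P'), (u', l'), snd (snd y))"
        "filling D' P' u' l' r' s'" "snd (snd y) = 1 \<longleftrightarrow> s' < r'"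
        "star_fill y = fill (u', l') (r', s') (D', P')"
      using repr[OF y refl] by blast
    interpret F: filling D P u l r s by (rule F(2))
    interpret F': filling D' P' u' l' r' s' by (rule F'(2))
    interpret E: sym_tableau F.E P by (rule F.sym_tableau_E)
    have E: "F.E = F'.E" "P = P'" using eq unfolding F(4) F'(4) fill_eq by auto
    have ul: "(u, l) = (u', l')"
      using E.is_star_special_unique[OF F.star_special_E] F'.star_special_E unfolding E by simp
    have rs: "(r, s) = (r', s')"
    proof (cases "(u, l + 1) \<in> F.E")
      case True
      then have "(r, s) \<noteq> (u, l)" "(r', s') \<noteq> (u', l')"
        using F.corner(4) F'.corner(4) rim_between_self ul E by auto
      then have "next_point F.E P (u, l) (r, s)" "next_point F.E P (u, l) (r', s')"
        using F.below_target(2) F'.below_target(2) ul E by auto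
      then show ?thesis using next_point_unique E.down_closed E.sub by (metis subrelI)
    next
      case False
      then have "(r, s) = (u, l)" "(r', s') = (u', l')"
        using F.below_target(1) F'.below_target(1) ul E by blast+
      then show ?thesis using ul by simp
    qed
    have "D = D'" using F.E_minus_inner_rim F'.E_minus_inner_rim E ul rs by metis
    moreover have "snd (snd x) = snd (snd y)"
      using F(3) F'(3) rs x y by auto
    ultimately show "x = y" using F(1) F'(1) E ul by metis
  next
    fix x assume x: "x \<in> ?X"
    obtain D P u l r s where F: "filling D P u l r s" "card P = m"
        "star_fill x = fill (u, l) (r, s) (D, P)"
      using repr[OF x refl] by blast
    interpret F: filling D P u l r s by (rule F(1))
    show "star_fill x \<in> sym_tableaux m"
      unfolding F(3) fill_eq sym_tableaux_iff using F.sym_tableau_E F(2) by simp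
  next
    fix T assume T: "T \<in> sym_tableaux m"
    obtain E P where EP: "T = (E, P)" by fastforce
    have E: "sym_tableau E P" "card P = m" using T EP sym_tableaux_iff by auto
    interpret E: sym_tableau E P by (rule E(1))
    obtain u l where special: "is_star_special (E, P) (u, l)"
      using E.ex_star_special_of_card m E(2) by auto
    then have ul: "(u, l) \<in> P" "l < u" "(u + 1, l) \<notin> E" unfolding E.is_star_special_iff by auto
    show "T \<in> star_fill ` ?X"
    proof (cases "(u, l + 1) \<in> E")
      case True
      then obtain r s where "unfilling E P u l r s" using E.ex_unfilling special by blast
      then interpret U: unfilling E P u l r s .
      interpret F: filling U.D P u l r s by (rule U.filling)
      \<comment> \<open>The side of the diagonal on which the second end lies gives the
        sign.\<close>
      let ?\<epsilon> = "if s < r then 1 else - 1 :: int"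
      have "((U.D, P), (u, l), ?\<epsilon>) \<in> ?X"
        using F.sym_tableau_axioms E(2) F.corner by (auto simp: sym_tableaux_iff lower_corners_def)
      moreover have "star_fill ((U.D, P), (u, l), ?\<epsilon>) = fill (u, l) (r, s) (U.D, P)"
      proof (cases "s < r")
        case True
        then have "is_star_special (U.D, P) (r, s)" using F.target F.corner(2) by auto
        then show ?thesis using True F.the_star_special unfolding star_fill_def by simp
      next
        case False
        then show ?thesis using U.target_cases unfolding star_fill_def by simp
      qed
      then have "T = star_fill ((U.D, P), (u, l), ?\<epsilon>)" unfolding fill_eq EP using U.E_eq by simp
      ultimately show ?thesis by (intro image_eqI)
    next
      case False
      \<comment> \<open>The special point is itself a corner here: nothing was added, and the
        tableau is its own preimage with sign 1.\<close>
      then have "((E, P), (u, l), 1) \<in> ?X"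
        using T EP ul by (auto simp: lower_corners_def)
      moreover have "star_fill ((E, P), (u, l), 1) = T"
        using E.the_star_special[OF special] EP
        by (simp add: star_fill_def fill_eq rim_between_self)
      ultimately show ?thesis by (intro image_eqI[OF sym])
    qed
  qed
qed

section \<open>Inserting and deleting a row and its mirror column\<close>

text \<open>The increasing injection of the naturals that omits \<open>k\<close>: it renumbers old
  lines around a new line of index \<open>k\<close>.\<close>

definition shift :: "nat \<Rightarrow> nat \<Rightarrow> nat" where
  "shift k i = (if i < k then i else i + 1)"

lemma shift_neq [simp]: "shift k i \<noteq> k" "k \<noteq> shift k i"
  unfolding shift_def by auto

lemma shift_eq_iff [simp]: "shift k i = shift k j \<longleftrightarrow> i = j"
  unfolding shift_def by auto

lemma shift_le_iff [simp]: "shift k i \<le> shift k j \<longleftrightarrow> i \<le> j"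
  unfolding shift_def by auto

lemma shift_less_iff [simp]: "shift k i < shift k j \<longleftrightarrow> i < j"
  unfolding shift_def by auto

lemma less_shift_iff: "k < shift k i \<longleftrightarrow> k \<le> i"
  unfolding shift_def by auto

lemma shift_le_self_iff: "shift k i \<le> k \<longleftrightarrow> i < k"
  unfolding shift_def by auto

lemma shift_cases:
  obtains "x = k" | i where "x = shift k i"
proof -
  have "x = shift k (if x < k then x else x - 1)" if "x \<noteq> k"
    using that unfolding shift_def by auto
  then show ?thesis using that by blast
qed

text \<open>Here \<open>c\<close> is an old index and \<open>shift k c\<close> its new value. One
  formula serves both kinds of lower edge, which differ only in whether
  \<open>c < k\<close>.\<close>

definition insert_at :: "nat \<Rightarrow> nat \<Rightarrow> tableau \<Rightarrow> tableau" where
  "insert_at k c T =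
     (map_prod (shift k) (shift k) ` fst T \<union> {(k, j) | j. j \<le> shift k c} \<union> {(i, k) | i. i \<le> shift k c},
      insert (k, shift k c) (insert (shift k c, k) (map_prod (shift k) (shift k) ` snd T)))"

text \<open>For a column c of height k > 0 this is its bottom edge or the mirror image of that edge,
  whichever is a lower edge.\<close>

definition edge_at :: "nat \<Rightarrow> nat \<Rightarrow> edge" where
  "edge_at k c = (if c < k then South (k - 1, c) else East (c, k - 1))"

lemma position_edge_at:
  "0 < k \<Longrightarrow> position (edge_at k c) = (if c < k then int c - int k else int k - int c - 1)"
  unfolding edge_at_def by auto

lemma moved_sym_edge_at: "0 < k \<Longrightarrow> moved_sym (edge_at k c) = map_prod (shift k) (shift k)"
  unfolding moved_sym_def edge_at_def shift_def by (auto simp: fun_eq_iff)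

lemma lower_new_point_edge_at:
  "0 < k \<Longrightarrow> lower_new_point (edge_at k c) = (max k (shift k c), min k (shift k c))"
  unfolding lower_new_point_def edge_at_def shift_def by auto

lemma upper_new_point_edge_at:
  "0 < k \<Longrightarrow> upper_new_point (edge_at k c) = (min k (shift k c), max k (shift k c))"
  unfolding upper_new_point_def edge_at_def shift_def by auto

lemma insert_sym_eq:
  "insert_sym e T =
     (moved_sym e ` fst T \<union> (moved (moved_mirror e) ` new_cells e \<union> new_cells (moved_mirror e)),
      insert (upper_new_point e) (insert (lower_new_point e) (moved_sym e ` snd T)))"
  unfolding insert_sym_def insert_line_def moved_sym_def upper_new_point_def lower_new_point_def
  by (simp add: image_Un image_image Un_assoc)

lemma new_cells_edge_at:
  assumes "0 < k"
  shows "moved (moved_mirror (edge_at k c)) ` new_cells (edge_at k c) \<union>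
      new_cells (moved_mirror (edge_at k c)) =
    {(k, j) | j. j \<le> shift k c} \<union> {(i, k) | i. i \<le> shift k c}"
proof (cases "c < k")
  case True
  then show ?thesis using assms unfolding edge_at_def shift_def by (auto simp: image_iff)
next
  case False
  have "new_cells (edge_at k c) = (\<lambda>i. (i, k)) ` {..c}"
    using assms False unfolding edge_at_def by auto
  \<comment> \<open>The column is inserted before the row, which pushes the column's cells down from
    row \<open>k\<close> on; the gap at \<open>(k, k)\<close> is filled by the row itself.\<close>
  moreover have "moved (moved_mirror (edge_at k c)) (i, k) = (shift k i, k)" for i
    using assms False unfolding edge_at_def shift_def by auto
  ultimately have old: "moved (moved_mirror (edge_at k c)) ` new_cells (edge_at k c) =
      (\<lambda>i. (i, k)) ` shift k ` {..c}"
    by (simp add: image_image)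
  have new: "new_cells (moved_mirror (edge_at k c)) = (\<lambda>j. (k, j)) ` {..c + 1}"
    using assms False unfolding edge_at_def by auto
  have "x \<in> shift k ` {..c}" if "x \<noteq> k" "x \<le> c + 1" for x
    using that False by (cases x k rule: shift_cases) (auto simp: shift_def split: if_splits)
  moreover have "shift k i \<le> c + 1" if "i \<le> c" for i using that unfolding shift_def by auto
  ultimately have range: "{..c + 1} = insert k (shift k ` {..c})" using False by force
  have "{(k, j) | j. j \<le> shift k c} \<union> {(i, k) | i. i \<le> shift k c} =
      (\<lambda>j. (k, j)) ` {..c + 1} \<union> (\<lambda>i. (i, k)) ` {..c + 1}"
    using False by (auto simp: shift_def)
  also have "\<dots> = (\<lambda>j. (k, j)) ` {..c + 1} \<union> (\<lambda>i. (i, k)) ` shift k ` {..c}"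
    unfolding range by auto
  finally have eq: "{(k, j) | j. j \<le> shift k c} \<union> {(i, k) | i. i \<le> shift k c} =
    (\<lambda>j. (k, j)) ` {..c + 1} \<union> (\<lambda>i. (i, k)) ` shift k ` {..c}" .
  show ?thesis unfolding old new eq by (rule Un_commute)
qed

lemma insert_sym_edge_at: "0 < k \<Longrightarrow> insert_sym (edge_at k c) T = insert_at k c T"
  unfolding insert_sym_eq insert_at_def new_cells_edge_at moved_sym_edge_at
    lower_new_point_edge_at upper_new_point_edge_at
  by (auto simp: max_def min_def)

text \<open>Reflection turns position \<open>p\<close> into \<open>- p - 1\<close>, so exactly one
  of an edge and its mirror image is lower. This indexes the lower edges by columns \<open>c\<close>
  of height \<open>k\<close>.\<close>

lemma (in sym_tableau) lower_edges_eq: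
  "lower_edges (D, P) = {edge_at k c | k c. 0 < k \<and> (k - 1, c) \<in> D \<and> (k, c) \<notin> D}"
proof (intro equalityI subsetI)
  fix e assume "e \<in> lower_edges (D, P)"
  then have e: "e \<in> boundary_edges D" "position e < 0" unfolding lower_edges_def by auto
  show "e \<in> {edge_at k c | k c. 0 < k \<and> (k - 1, c) \<in> D \<and> (k, c) \<notin> D}"
  proof (cases e)
    case (South p)
    obtain i j where "p = (i, j)" by fastforce
    then have "e = edge_at (i + 1) j" "(i, j) \<in> D" "(i + 1, j) \<notin> D"
      using e South unfolding boundary_edges_def edge_at_def by auto
    then show ?thesis by force
  next
    case (East p)
    obtain i j where "p = (i, j)" by fastforce
    then have "e = edge_at (j + 1) i" "(j, i) \<in> D" "(j + 1, i) \<notin> D"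
      using e East symD unfolding boundary_edges_def edge_at_def by auto
    then show ?thesis by force
  qed
next
  fix e assume "e \<in> {edge_at k c | k c. 0 < k \<and> (k - 1, c) \<in> D \<and> (k, c) \<notin> D}"
  then obtain k c where e: "e = edge_at k c" "0 < k" "(k - 1, c) \<in> D" "(k, c) \<notin> D" by blast
  then have "(c, k - 1) \<in> D" "(c, k) \<notin> D" using symD by blast+
  then have "e \<in> boundary_edges D" using e unfolding boundary_edges_def edge_at_def by auto
  then show "e \<in> lower_edges (D, P)"
    using e position_edge_at[of k c] unfolding lower_edges_def by auto
qed

section \<open>Inserting a row and its mirror column\<close>

locale insertion = sym_tableau +
  fixes k c :: nat
  assumes k: "0 < k" and column: "(k - 1, c) \<in> D" "(k, c) \<notin> D"
begin

abbreviation "m \<equiv> shift k c"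

abbreviation "D' \<equiv> fst (insert_at k c (D, P))"

abbreviation "P' \<equiv> snd (insert_at k c (D, P))"

lemma D'_iff:
  "(shift k i, shift k j) \<in> D' \<longleftrightarrow> (i, j) \<in> D"
  "(k, y) \<in> D' \<longleftrightarrow> y \<le> m"
  "(x, k) \<in> D' \<longleftrightarrow> x \<le> m"
  unfolding insert_at_def by auto

lemma P'_iff:
  "(shift k i, shift k j) \<in> P' \<longleftrightarrow> (i, j) \<in> P"
  "(k, y) \<in> P' \<longleftrightarrow> y = m"
  "(x, k) \<in> P' \<longleftrightarrow> x = m"
  unfolding insert_at_def by auto

lemma column_sym: "(c, k - 1) \<in> D" "(c, k) \<notin> D"
  using column symD by blast+

text \<open>Column \<open>c\<close> contains a point and ends above the new row. Thus
  \<open>(k, m)\<close> has its parent above it and \<open>(m, k)\<close> has its parent to the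
  left.\<close>

lemma above_new: "\<exists>i < k. (i, m) \<in> P'"
proof -
  obtain i where i: "(i, c) \<in> P" using row[OF symD[OF column(1)]] symP by blast
  have "i < k" using down[OF sub[OF i], of k c] column(2) by (meson linorder_not_less order_refl)
  moreover from this have "(i, m) \<in> P'" using i P'_iff(1)[of i c] unfolding shift_def by auto
  ultimately show ?thesis by blast
qed

lemma sym_tableau_insert: "sym_tableau D' P'"
proof
  have "finite {(k, j) | j. j \<le> m}" "finite {(i, k) | i. i \<le> m}" by auto
  then show "finite D'" using fin unfolding insert_at_def by auto
  show symD': "(x, y) \<in> D' \<Longrightarrow> (y, x) \<in> D'" for x y
    by (cases x k rule: shift_cases; cases y k rule: shift_cases) (auto simp: D'_iff intro: symD)
  show symP': "(x, y) \<in> P' \<Longrightarrow> (y, x) \<in> P'" for x y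
    by (cases x k rule: shift_cases; cases y k rule: shift_cases) (auto simp: P'_iff intro: symP)
  show "(x, y) \<in> P' \<Longrightarrow> (x, y) \<in> D'" for x y
    by (cases x k rule: shift_cases; cases y k rule: shift_cases)
      (auto simp: P'_iff D'_iff intro: sub)
  show "(0, 0) \<in> P'" using P'_iff(1)[of 0 0] root k unfolding shift_def by auto
  show "(x', y') \<in> D'" if xy: "(x, y) \<in> D'" and le: "x' \<le> x" "y' \<le> y" for x y x' y'
  proof -
    \<comment> \<open>From row \<open>k\<close> on nothing reaches beyond column \<open>m\<close>:
      the new row ends there, and the old column \<open>c\<close> has height
      \<open>k\<close>.\<close>
    have new: "y' \<le> m" if "(x, y) \<in> D'" "k \<le> x" "y' \<le> y" for x y y'
    proof (cases x k rule: shift_cases)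
      case 1
      then show ?thesis using that D'_iff(2) by auto
    next
      case (2 i)
      then have i: "k \<le> i" using that(2) by (metis le_neq_implies_less less_shift_iff shift_neq(2))
      show ?thesis
      proof (cases y k rule: shift_cases)
        case 1
        then have "i \<le> c" using that(1) 2 D'_iff(3) by auto
        then have "k < m" using i by (simp add: less_shift_iff)
        then show ?thesis using 1 that(3) by simp
      next
        case (2 j)
        then have "(i, j) \<in> D" using that(1) \<open>x = shift k i\<close> D'_iff(1) by simp
        then have "j < c" using down[of i j k c] column(2) i by (meson linorder_not_less)
        then have "y < m" using 2 by simp
        then show ?thesis using that(3) by simp
      qed
    qed
    show ?thesis
    proof (cases x' k rule: shift_cases)
      case 1
      then show ?thesis using new[OF xy, of y'] le D'_iff(2) by auto
    next
      case (2 i')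
      show ?thesis
      proof (cases y' k rule: shift_cases)
        case 1
        then show ?thesis using new[OF symD'[OF xy], of x'] le D'_iff(3) by auto
      next
        case (2 j')
        have "(i', j') \<in> D"
        proof (cases x k rule: shift_cases)
          case 1
          then have "y \<le> m" using xy by (simp add: D'_iff)
          with le(2) have "y' \<le> m" by (rule order_trans)
          then have "i' < k" "j' \<le> c"
            using le(1) 1 \<open>x' = shift k i'\<close> \<open>y' = shift k j'\<close> by (simp_all add: shift_le_self_iff)
          then show ?thesis using down[OF column(1), of i' j'] by simp
        next
          case (2 i)
          show ?thesis
          proof (cases y k rule: shift_cases)
            case 1
            then have "x \<le> m" using xy by (simp add: D'_iff)
            with le(1) have "x' \<le> m" by (rule order_trans)
            then have "j' < k" "i' \<le> c"
              using le(2) 1 \<open>x' = shift k i'\<close> \<open>y' = shift k j'\<close> by (simp_all add: shift_le_self_iff)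
            then show ?thesis using down[OF column_sym(1), of i' j'] by simp
          next
            case (2 j)
            then show ?thesis
              using le xy \<open>x' = shift k i'\<close> \<open>y' = shift k j'\<close> \<open>x = shift k i\<close> down[of i j i' j']
              by (simp add: D'_iff)
          qed
        qed
        then show ?thesis using 2 \<open>x' = shift k i'\<close> D'_iff(1) by simp
      qed
    qed
  qed
  \<comment> \<open>A new point above an old one would put the old point into column
    \<open>c\<close> at row \<open>k\<close> or lower, outside the old diagram.\<close>
  have above: "(\<exists>x' < shift k i. (x', shift k j) \<in> P') \<longleftrightarrow> (\<exists>i' < i. (i', j) \<in> P)"
    if ij: "(i, j) \<in> P" for i j
  proof
    assume "\<exists>x' < shift k i. (x', shift k j) \<in> P'"
    then obtain x' where x': "x' < shift k i" "(x', shift k j) \<in> P'" by blast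
    show "\<exists>i' < i. (i', j) \<in> P"
    proof (cases x' k rule: shift_cases)
      case 1
      then have "j = c" "k \<le> i" using x' by (auto simp: P'_iff less_shift_iff)
      then show ?thesis using down[OF sub[OF ij], of k c] column(2) by simp
    next
      case (2 i')
      then show ?thesis using x' by (auto simp: P'_iff)
    qed
  next
    assume "\<exists>i' < i. (i', j) \<in> P"
    then obtain i' where "i' < i" "(i', j) \<in> P" by blast
    then show "\<exists>x' < shift k i. (x', shift k j) \<in> P'"
      by (intro exI[of _ "shift k i'"]) (simp add: P'_iff)
  qed
  have new_tree: "(\<exists>x' < k. (x', m) \<in> P') \<and> \<not> (\<exists>y' < m. (k, y') \<in> P')"
    using above_new by (auto simp: P'_iff)
  show "(\<exists>x' < x. (x', y) \<in> P') \<noteq> (\<exists>y' < y. (x, y') \<in> P')"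
    if xy: "(x, y) \<in> P'" "(x, y) \<noteq> (0, 0)" for x y
  proof (cases x k rule: shift_cases)
    case 1
    then have "y = m" using xy P'_iff(2) by simp
    then show ?thesis using 1 new_tree by blast
  next
    case (2 i)
    show ?thesis
    proof (cases y k rule: shift_cases)
      case 1
      then have "x = m" using xy P'_iff(3) by simp
      then show ?thesis using 1 new_tree symP' by blast
    next
      case (2 j)
      have ij: "(i, j) \<in> P" using xy(1) 2 \<open>x = shift k i\<close> P'_iff(1) by simp
      have "(i, j) \<noteq> (0, 0)" using xy(2) 2 \<open>x = shift k i\<close> k
        by (auto simp: shift_def split: if_splits)
      then have "(\<exists>i' < i. (i', j) \<in> P) \<noteq> (\<exists>j' < j. (j', i) \<in> P)"
        using tree[OF ij] symP by blast
      then show ?thesis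
        using above[OF ij] above[OF symP[OF ij]] symP' 2 \<open>x = shift k i\<close> by blast
    qed
  qed
  show "\<exists>y'. (x, y') \<in> P'" if "(x, y) \<in> D'" for x y
  proof (cases x k rule: shift_cases)
    case 1
    then show ?thesis using P'_iff(2) by blast
  next
    case (2 i)
    have "\<exists>j. (i, j) \<in> D"
    proof (cases y k rule: shift_cases)
      case 1
      then have "i \<le> c" using that 2 by (simp add: D'_iff)
      then show ?thesis using down[OF column_sym(1)] by blast
    next
      case (2 j)
      then show ?thesis using that \<open>x = shift k i\<close> D'_iff(1) by auto
    qed
    then obtain j where "(i, j) \<in> P" using row by blast
    then show ?thesis using 2 P'_iff(1) by blast
  qed
qed

lemma card_insert: "card P' = card P + 2"
proof -
  have "finite P" using sub by (intro finite_subset[OF _ fin]) auto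
  moreover have "inj (map_prod (shift k) (shift k))" by (auto simp: inj_def)
  ultimately show ?thesis
    unfolding insert_at_def by (auto simp: card_image inj_on_subset card_insert_if image_iff)
qed

lemma new_corner: "(k, m) \<in> P'" "(k + 1, m) \<notin> D'" "(k, m + 1) \<notin> D'"
proof -
  show "(k, m) \<in> P'" by (simp add: P'_iff)
  show "(k, m + 1) \<notin> D'" by (simp add: D'_iff)
  have "shift k k = k + 1" by (simp add: shift_def)
  then show "(k + 1, m) \<notin> D'" using D'_iff(1)[of k c] column(2) by simp
qed

sublocale ins: sym_tableau D' P' by (rule sym_tableau_insert)

lemma lower_corner: "(max k m, min k m) \<in> lower_corners (insert_at k c (D, P))"
proof -
  have "m < k \<or> k < m" using shift_neq[of k c] by linarith
  then show ?thesis
    using new_corner ins.symP[of k m] ins.symD[of "m + 1" k] ins.symD[of m "k + 1"]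
    unfolding lower_corners_def by (elim disjE) auto
qed

lemma old_bottom:
  assumes "(shift k i + 1, shift k j) \<notin> D'"
  shows "(i + 1, j) \<notin> D"
proof
  assume "(i + 1, j) \<in> D"
  then have "(shift k (i + 1), shift k j) \<in> D'" by (simp add: D'_iff)
  moreover have "shift k i + 1 \<le> shift k (i + 1)" by (simp add: shift_def)
  ultimately show False using ins.down assms by blast
qed

text \<open>A later edge of the border path lies weakly further right, so the old special point does
  not pass the new corner, and old points that are bottom points now were so before. The hypothesis
  is vacuous without an old special point.\<close>

lemma new_star_special:
  assumes "\<And>p. is_star_special (D, P) p \<Longrightarrow>
    edge_at k c = South p \<or> position (South p) < position (edge_at k c)"
  shows "is_star_special (D', P') (max k m, min k m)"
proof -
  have "y \<le> min k m" if xy: "(x, y) \<in> P'" "(x + 1, y) \<notin> D'" "y < x" for x y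
  proof (cases "x = k \<or> y = k")
    case True
    then show ?thesis using xy by (auto simp: P'_iff)
  next
    case False
    then obtain i j where ij: "x = shift k i" "y = shift k j" by (metis shift_cases)
    then have "(i, j) \<in> P" "(i + 1, j) \<notin> D" "j < i"
      using xy old_bottom[of i j] by (auto simp: P'_iff)
    then obtain r s where p: "is_star_special (D, P) (r, s)" "j \<le> s"
      using ex_star_special is_star_special_iff by (metis surj_pair)
    then have rs: "(r, s) \<in> D" "s < r" using sub unfolding is_star_special_iff by auto
    have "shift k s \<le> min k m"
      using assms[OF p(1)]
    proof
      assume "edge_at k c = South (r, s)"
      then have "c < k" "s = c" using k by (auto simp: edge_at_def split: if_splits)
      then show ?thesis by (simp add: shift_def)
    next
      assume pos: "position (South (r, s)) < position (edge_at k c)"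
      show ?thesis
      proof (cases "c < k")
        case True
        have "\<not> c < s"
          using down[OF rs(1), of k c] column(2) pos True k by (auto simp: position_edge_at)
        then show ?thesis using True by (auto simp: shift_def)
      next
        case False
        have "\<not> k \<le> s"
          using down[OF rs(1), of c k] column_sym(2) pos False k by (auto simp: position_edge_at)
        then show ?thesis using False by (auto simp: shift_def)
      qed
    qed
    then show ?thesis using p(2) ij(2) by (meson order_trans shift_le_iff)
  qed
  then show ?thesis
    using lower_corner unfolding ins.is_star_special_iff lower_corners_def by auto
qed

lemma old_star_special:
  assumes p: "is_star_special (D, P) (r, s)"
    and pos: "position (edge_at k c) \<le> position (South (r, s))" "edge_at k c \<noteq> South (r, s)"
  shows "is_star_special (D', P') (shift k r, shift k s)"
    and "min k m < shift k s"
proof -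
  have rs: "(r, s) \<in> P" "s < r" "(r + 1, s) \<notin> D"
    and max: "\<And>i j. (i, j) \<in> P \<Longrightarrow> (i + 1, j) \<notin> D \<Longrightarrow> j < i \<Longrightarrow> j \<le> s"
    using p unfolding is_star_special_iff by auto
  show ls: "min k m < shift k s"
  proof (cases "c < k")
    case True
    have "\<not> s \<le> c"
    proof
      assume s: "s \<le> c"
      have "k - 1 \<le> r" using down[OF column(1), of "r + 1" s] rs(3) s by linarith
      then have "r = k - 1" "s = c" using pos(1) True s k by (auto simp: position_edge_at)
      then show False using pos(2) True by (simp add: edge_at_def)
    qed
    then show ?thesis using True by (auto simp: shift_def)
  next
    case False
    have "\<not> s < k"
    proof
      assume s: "s < k"
      have "c \<le> r" using down[OF column_sym(1), of "r + 1" s] rs(3) s by linarith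
      then show False using pos(1) False s k by (auto simp: position_edge_at)
    qed
    then show ?thesis using False by (auto simp: shift_def)
  qed
  \<comment> \<open>For \<open>r = k - 1\<close> the inserted row runs directly under the row of the
    special point but ends before its column.\<close>
  have "(shift k r + 1, shift k s) \<notin> D'"
  proof (cases "r = k - 1")
    case True
    have "\<not> shift k s \<le> m"
    proof
      assume "shift k s \<le> m"
      then have "k < shift k s" using ls by (auto simp: min_def split: if_splits)
      then show False using True rs(2) by (simp add: less_shift_iff)
    qed
    then show ?thesis using True k by (simp add: shift_def D'_iff)
  next
    case False
    then have "shift k r + 1 = shift k (r + 1)" by (auto simp: shift_def)
    then show ?thesis using rs(3) by (simp add: D'_iff)
  qed
  moreover have "y \<le> shift k s" if xy: "(x, y) \<in> P'" "(x + 1, y) \<notin> D'" "y < x" for x y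
  proof (cases "x = k \<or> y = k")
    case True
    then show ?thesis using xy ls by (auto simp: P'_iff)
  next
    case False
    then obtain i j where ij: "x = shift k i" "y = shift k j" by (metis shift_cases)
    then show ?thesis using xy old_bottom[of i j] max[of i j] by (simp add: P'_iff)
  qed
  ultimately show "is_star_special (D', P') (shift k r, shift k s)"
    unfolding ins.is_star_special_iff using rs by (auto simp: P'_iff)
qed

end

section \<open>Deleting a corner together with its row and column\<close>

locale deletion = sym_tableau +
  fixes k c :: nat
  assumes corner: "(k, shift k c) \<in> P" "(k + 1, shift k c) \<notin> D" "(k, shift k c + 1) \<notin> D"
    and above: "\<exists>i < k. (i, shift k c) \<in> P"
begin

abbreviation "m \<equiv> shift k c"

abbreviation "D\<^sub>0 \<equiv> map_prod (shift k) (shift k) -` D"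

abbreviation "P\<^sub>0 \<equiv> map_prod (shift k) (shift k) -` P"

lemma k_pos: "0 < k"
  using above by auto

text \<open>The corner has a point above it and hence none to its left; to its right the diagram
  ends.\<close>

lemma row_k: "(k, y) \<in> P \<longleftrightarrow> y = m"
proof
  assume y: "(k, y) \<in> P"
  have "\<not> y < m" using tree[OF corner(1)] y k_pos above by blast
  moreover have "\<not> m < y" using down[OF sub[OF y], of k "m + 1"] corner(3) by auto
  ultimately show "y = m" by simp
qed (use corner in simp)

lemma column_k: "(x, k) \<in> P \<longleftrightarrow> x = m"
  using row_k symP by blast

lemma row_k_D: "(k, y) \<in> D \<longleftrightarrow> y \<le> m"
  using down[of k y k "m + 1"] down[OF sub[OF corner(1)], of k y] corner(3) by fastforce

lemma column_k_D: "(x, k) \<in> D \<longleftrightarrow> x \<le> m"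
  using row_k_D symD by blast

lemma sym_tableau_delete: "sym_tableau D\<^sub>0 P\<^sub>0"
proof
  have "inj (map_prod (shift k) (shift k))" by (auto simp: inj_def)
  then show "finite D\<^sub>0" by (rule finite_vimageI[OF fin])
  show "(i', j') \<in> D\<^sub>0" if "(i, j) \<in> D\<^sub>0" "i' \<le> i" "j' \<le> j" for i j i' j'
    using that down[of "shift k i" "shift k j" "shift k i'" "shift k j'"] by simp
  show "(i, j) \<in> D\<^sub>0 \<Longrightarrow> (j, i) \<in> D\<^sub>0" for i j using symD by simp
  show symP\<^sub>0: "(i, j) \<in> P\<^sub>0 \<Longrightarrow> (j, i) \<in> P\<^sub>0" for i j using symP by simp
  show "(i, j) \<in> P\<^sub>0 \<Longrightarrow> (i, j) \<in> D\<^sub>0" for i j using sub by simp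
  have "shift k 0 = 0" using k_pos unfolding shift_def by simp
  then show "(0, 0) \<in> P\<^sub>0" using root by simp
  have above_iff: "(\<exists>i' < i. (i', j) \<in> P\<^sub>0) \<longleftrightarrow> (\<exists>x < shift k i. (x, shift k j) \<in> P)"
    if ij: "(i, j) \<in> P\<^sub>0" for i j
  proof
    assume "\<exists>i' < i. (i', j) \<in> P\<^sub>0"
    then show "\<exists>x < shift k i. (x, shift k j) \<in> P" by (metis map_prod_simp shift_less_iff vimageE)
  next
    assume "\<exists>x < shift k i. (x, shift k j) \<in> P"
    then obtain x where x: "x < shift k i" "(x, shift k j) \<in> P" by blast
    show "\<exists>i' < i. (i', j) \<in> P\<^sub>0"
    proof (cases x k rule: shift_cases)
      case 1
      then have "shift k j = m" using x(2) row_k by simp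
      then have "(shift k i, m) \<in> D" using ij sub by auto
      then show ?thesis using down[of "shift k i" m "k + 1" m] corner(2) x(1) 1 by auto
    next
      case (2 i')
      then show ?thesis using x by auto
    qed
  qed
  show "(\<exists>i' < i. (i', j) \<in> P\<^sub>0) \<noteq> (\<exists>j' < j. (i, j') \<in> P\<^sub>0)"
    if ij: "(i, j) \<in> P\<^sub>0" "(i, j) \<noteq> (0, 0)" for i j
  proof -
    have "(shift k i, shift k j) \<noteq> (0, 0)"
      using ij(2) \<open>shift k 0 = 0\<close> shift_eq_iff[of k _ 0] by fastforce
    then have "(\<exists>x < shift k i. (x, shift k j) \<in> P) \<noteq> (\<exists>y < shift k j. (y, shift k i) \<in> P)"
      using tree[of "shift k i" "shift k j"] ij(1) symP by auto
    then show ?thesis using above_iff[OF ij(1)] above_iff[OF symP\<^sub>0[OF ij(1)]] symP\<^sub>0 by blast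
  qed
  show "\<exists>j'. (i, j') \<in> P\<^sub>0" if ij: "(i, j) \<in> D\<^sub>0" for i j
  proof -
    \<comment> \<open>Row \<open>m\<close> loses its point in column \<open>k\<close> but keeps the
      mirror image of the point above the corner.\<close>
    have "\<exists>y. y \<noteq> k \<and> (shift k i, y) \<in> P"
    proof (cases "shift k i = m")
      case True
      then show ?thesis using above symP by (metis less_irrefl)
    next
      case False
      obtain y where y: "(shift k i, y) \<in> P" using row[of "shift k i" "shift k j"] ij by auto
      then have "y \<noteq> k" using False column_k[of "shift k i"] by metis
      then show ?thesis using y by blast
    qed
    then show ?thesis by (metis map_prod_simp shift_cases vimageI)
  qed
qed

sublocale insertion: insertion D\<^sub>0 P\<^sub>0 k c
proof -
  interpret del: sym_tableau D\<^sub>0 P\<^sub>0 by (rule sym_tableau_delete)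
  have "shift k (k - 1) = k - 1" "shift k k = k + 1" using k_pos unfolding shift_def by auto
  moreover have "(k - 1, m) \<in> D" using down[OF sub[OF corner(1)]] by simp
  ultimately show "insertion D\<^sub>0 P\<^sub>0 k c"
    using k_pos corner(2) by unfold_locales auto
qed

lemma insert_delete: "insert_at k c (D\<^sub>0, P\<^sub>0) = (D, P)"
proof -
  have "(x, y) \<in> insertion.D' \<longleftrightarrow> (x, y) \<in> D" for x y
    by (cases x k rule: shift_cases; cases y k rule: shift_cases)
      (simp_all add: insertion.D'_iff row_k_D column_k_D)
  moreover have "(x, y) \<in> insertion.P' \<longleftrightarrow> (x, y) \<in> P" for x y
    by (cases x k rule: shift_cases; cases y k rule: shift_cases)
      (simp_all add: insertion.P'_iff row_k column_k)
  ultimately have "insertion.D' = D" "insertion.P' = P"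
    by (intro set_eqI; metis surj_pair)+
  then show ?thesis by (simp add: prod_eq_iff)
qed

end

section \<open>The first step as a bijection\<close>

text \<open>The corner yields \<open>k\<close> and \<open>shift k c\<close> only as an unordered
  pair. If the two readings were swapped, one would require a second point in column
  \<open>k\<close>, above the new one, and the other would forbid it.\<close>

lemma insertion_inject:
  assumes "insertion D P k c" "insertion D' P' k' c'"
    and eq: "insert_at k c (D, P) = insert_at k' c' (D', P')"
    and corner: "max k (shift k c) = max k' (shift k' c')" "min k (shift k c) = min k' (shift k' c')"
  shows "k = k'" "c = c'" "D = D'" "P = P'"
proof -
  interpret X: insertion D P k c by (rule assms(1))
  interpret Y: insertion D' P' k' c' by (rule assms(2))
  have "\<not> (k = Y.m \<and> X.m = k')"
    using Y.above_new X.P'_iff(2) X.P'_iff(3) eq X.ins.symP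
    by (metis less_irrefl)
  then show k: "k = k'" using corner by (auto simp: max_def min_def split: if_splits)
  then have "X.m = Y.m" using corner by (auto simp: max_def min_def split: if_splits)
  then show c: "c = c'" using k by simp
  have "(i, j) \<in> D \<longleftrightarrow> (i, j) \<in> D'" "(i, j) \<in> P \<longleftrightarrow> (i, j) \<in> P'" for i j
    using X.D'_iff(1) Y.D'_iff(1) X.P'_iff(1) Y.P'_iff(1) eq k by metis+
  then show "D = D'" "P = P'" by auto
qed

definition insert_marked :: "tableau \<times> edge \<times> int \<Rightarrow> tableau \<times> cell \<times> int" where
  "insert_marked = (\<lambda>(T, e, \<epsilon>). (insert_sym e T, lower_new_point e, \<epsilon>))"

lemma insertion_of_lower_edge:
  assumes "T \<in> sym_tableaux m" "e \<in> lower_edges T"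
  obtains D P k c where "T = (D, P)" "card P = m" "insertion D P k c" "e = edge_at k c"
proof -
  obtain D P where T: "T = (D, P)" by fastforce
  then have DP: "sym_tableau D P" "card P = m" using assms(1) sym_tableaux_iff by auto
  interpret sym_tableau D P by (rule DP(1))
  obtain k c where kc: "e = edge_at k c" "0 < k" "(k - 1, c) \<in> D" "(k, c) \<notin> D"
    using assms(2) unfolding T lower_edges_eq by blast
  then have "insertion D P k c" by unfold_locales
  then show ?thesis using that T DP(2) kc(1) by blast
qed

lemma (in insertion) insert_marked_edge_at:
  "insert_marked ((D, P), edge_at k c, \<epsilon>) = (insert_at k c (D, P), (max k m, min k m), \<epsilon>)"
  unfolding insert_marked_def using k by (simp add: insert_sym_edge_at lower_new_point_edge_at)

lemma bij_betw_insert_marked: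
  "bij_betw insert_marked
    {(T, e, \<epsilon>). T \<in> sym_tableaux m \<and> e \<in> lower_edges T \<and> \<epsilon> \<in> E}
    {(T, a, \<epsilon>). T \<in> sym_tableaux (m + 2) \<and> a \<in> lower_corners T \<and> \<epsilon> \<in> E}"
    (is "bij_betw _ ?X ?Y")
  unfolding bij_betw_def
proof (intro conjI inj_onI equalityI image_subsetI subsetI)
  fix x y assume x: "x \<in> ?X" and y: "y \<in> ?X" and eq: "insert_marked x = insert_marked y"
  obtain T e \<epsilon> where x': "x = (T, e, \<epsilon>)" "T \<in> sym_tableaux m" "e \<in> lower_edges T" using x by auto
  obtain T' e' \<epsilon>' where y': "y = (T', e', \<epsilon>')" "T' \<in> sym_tableaux m" "e' \<in> lower_edges T'"
    using y by auto
  obtain D P k c where X: "T = (D, P)" "insertion D P k c" "e = edge_at k c"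
    using insertion_of_lower_edge[OF x'(2,3)] by metis
  obtain D' P' k' c' where Y: "T' = (D', P')" "insertion D' P' k' c'" "e' = edge_at k' c'"
    using insertion_of_lower_edge[OF y'(2,3)] by metis
  note eqs = eq[unfolded x'(1) y'(1) X(1,3) Y(1,3)
      insertion.insert_marked_edge_at[OF X(2)] insertion.insert_marked_edge_at[OF Y(2)]]
  show "x = y" using insertion_inject[OF X(2) Y(2)] eqs x'(1) y'(1) X(1,3) Y(1,3) by auto
next
  fix x assume x: "x \<in> ?X"
  obtain T e \<epsilon> where x': "x = (T, e, \<epsilon>)" "T \<in> sym_tableaux m" "e \<in> lower_edges T" "\<epsilon> \<in> E"
    using x by auto
  obtain D P k c where X: "T = (D, P)" "card P = m" "insertion D P k c" "e = edge_at k c"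
    using insertion_of_lower_edge[OF x'(2,3)] by metis
  interpret insertion D P k c by (rule X(3))
  have "insert_at k c (D, P) \<in> sym_tableaux (m + 2)"
    using sym_tableaux_iff[of D' P' "m + 2"] sym_tableau_insert card_insert X(2) by simp
  then show "insert_marked x \<in> ?Y"
    unfolding x'(1) X(1,4) insert_marked_edge_at using lower_corner x'(4) by simp
next
  fix y assume y: "y \<in> ?Y"
  obtain D P u l \<epsilon> where y': "y = ((D, P), (u, l), \<epsilon>)" by (metis surj_pair)
  have T: "sym_tableau D P" "card P = m + 2" "(u, l) \<in> P" "l < u" "(u + 1, l) \<notin> D" "(u, l + 1) \<notin> D"
    "\<epsilon> \<in> E"
    using y unfolding y' by (auto simp: sym_tableaux_iff lower_corners_def)
  interpret sym_tableau D P by (rule T(1))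
  have mirror: "(l, u) \<in> P" "(l + 1, u) \<notin> D" "(l, u + 1) \<notin> D" using T symP symD by blast+
  \<comment> \<open>If the corner has no point above it, it has one to its left, and its mirror
    image has one above.\<close>
  have "\<exists>k m. (k = u \<and> m = l \<or> k = l \<and> m = u) \<and> (\<exists>i < k. (i, m) \<in> P)"
    using tree[OF T(3)] T(4) symP by (metis Pair_inject not_less_zero)
  then obtain k m' where km: "k = u \<and> m' = l \<or> k = l \<and> m' = u" "\<exists>i < k. (i, m') \<in> P" by blast
  then have "m' \<noteq> k" using T(4) by auto
  then obtain c where c: "m' = shift k c" using shift_cases by metis
  have "deletion D P k c" using km T mirror unfolding c by unfold_locales auto
  then interpret deletion D P k c .
  let ?x = "((D\<^sub>0, P\<^sub>0), edge_at k c, \<epsilon>)"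
  have "card P\<^sub>0 = m" using insertion.card_insert T(2) insert_delete by simp
  then have "?x \<in> ?X"
    using insertion.lower_edges_eq insertion.k insertion.column sym_tableau_delete T(7)
    by (auto simp: sym_tableaux_iff)
  moreover have "y = insert_marked ?x"
    using km(1) T(4) unfolding y' insertion.insert_marked_edge_at insert_delete c
    by (auto simp: max_def min_def)
  ultimately show "y \<in> insert_marked ` ?X" by (intro image_eqI)
qed

section \<open>Agreement with the insertion procedure\<close>

lemma (in insertion) insertpoint_star_edge_at:
  assumes "\<epsilon> \<in> {1, - 1}"
  shows "insertpoint_star (D, P) (edge_at k c) \<epsilon> =
    star_fill (insert_at k c (D, P), (max k m, min k m), \<epsilon>)"
proof -
  let ?e = "edge_at k c"
  let ?u = "max k m" and ?l = "min k m"
  have ul: "(?u, ?l) \<in> P'" "?l < ?u" "(?u + 1, ?l) \<notin> D'" "(?u, ?l + 1) \<notin> D'"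
    using lower_corner unfolding lower_corners_def by auto
  have ribbon: "ribbon D' (right_of (?u, ?l)) (below (r, s)) = rim_between D' (?u, ?l) (r, s)"
    if "(r, s) \<noteq> (?u, ?l)" "(r, s) = (?l, ?u) \<or> is_star_special (D', P') (r, s)" for r s
  proof -
    interpret filling D' P' ?u ?l r s using ul that(2) by unfold_locales auto
    show ?thesis
      unfolding right_of_def below_def fst_conv snd_conv
      using ribbon_eq[OF ins.fin ins.down_closed ins.sub[OF ul(1)] ul(4) ins.sub[OF target_point(1)]
          target_point(2)] target_strict[OF that(1)] by blast
  qed
  note simps = insertpoint_star_def star_fill_def insert_sym_edge_at[OF k] Let_def
    lower_new_point_edge_at[OF k] upper_new_point_edge_at[OF k] moved_sym_edge_at[OF k]
  have T': "insert_at k c (D, P) = (D', P')" by simp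
  show ?thesis
  proof (cases "\<epsilon> = 1")
    case False
    let ?R = "rim_between D' (?u, ?l) (?l, ?u)"
    \<comment> \<open>For sign -1 the rim is its own mirror image, so adding the mirror image as
      well, as \<open>fill\<close> does, changes nothing.\<close>
    have "(x, y) \<in> prod.swap ` ?R \<longleftrightarrow> (x, y) \<in> ?R" for x y
      unfolding pair_in_swap_image rim_between_def using ins.symD by auto
    then have "prod.swap ` ?R = ?R" by (intro set_eqI) (metis surj_pair)
    moreover have "ribbon D' (right_of (?u, ?l)) (below (?l, ?u)) = ?R"
      using ribbon[of ?l ?u] ul(2) by auto
    ultimately show ?thesis using False unfolding simps fill_def by simp
  next
    case True
    show ?thesis
    proof (cases "\<exists>p. is_star_special (D, P) p \<and> position ?e \<le> position (South p)")
      case pos: True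
      then obtain r s where p: "is_star_special (D, P) (r, s)"
        "position ?e \<le> position (South (r, s))"
        by auto
      have the: "(THE p. is_star_special (D, P) p) = (r, s)" by (rule the_star_special[OF p(1)])
      show ?thesis
      proof (cases "?e = South (r, s)")
        case e: True
        \<comment> \<open>The new corner takes over as special point, and the rim from it to itself
          is empty, matching the empty ribbon.\<close>
        have "is_star_special (D', P') (?u, ?l)"
          using new_star_special p(1) is_star_special_unique e by metis
        then have "(THE p. is_star_special (D', P') p) = (?u, ?l)" by (rule ins.the_star_special)
        then show ?thesis
          using True pos the e unfolding simps fill_def by (simp add: rim_between_self)
      next
        case False
        have q: "is_star_special (D', P') (shift k r, shift k s)" "?l < shift k s"
          using old_star_special[OF p False] by auto
        have "(THE p. is_star_special (D', P') p) = (shift k r, shift k s)"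
          by (rule ins.the_star_special[OF q(1)])
        moreover have "ribbon D' (right_of (?u, ?l)) (below (shift k r, shift k s)) =
            rim_between D' (?u, ?l) (shift k r, shift k s)"
          using ribbon q by auto
        ultimately show ?thesis using True pos the False unfolding simps fill_def by simp
      qed
    next
      case npos: False
      then have "is_star_special (D', P') (?u, ?l)" using new_star_special by (metis not_less)
      then have "(THE p. is_star_special (D', P') p) = (?u, ?l)" by (rule ins.the_star_special)
      then have "star_fill (insert_at k c (D, P), (?u, ?l), \<epsilon>) = insert_at k c (D, P)"
        using True unfolding star_fill_def fill_def
        by (simp add: rim_between_self add_empty_def)
      moreover have "insertpoint_star (D, P) ?e \<epsilon> = insert_at k c (D, P)"
        unfolding insertpoint_star_def insert_sym_edge_at[OF k] Let_def if_not_P[OF npos]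
        using True by simp
      ultimately show ?thesis by simp
    qed
  qed
qed

theorem theorem2p7:
  fixes n :: nat
  shows "bij_betw (\<lambda>(T, e, \<epsilon>). insertpoint_star T e \<epsilon>)
           {(T, e, \<epsilon>). T \<in> sym_tableaux (2 * n + 1) \<and> e \<in> lower_edges T \<and> \<epsilon> \<in> {1, -1}}
           (sym_tableaux (2 * n + 3))"
    (is "bij_betw ?f ?X ?Z")
proof -
  have "bij_betw (star_fill \<circ> insert_marked) ?X ?Z"
    using bij_betw_trans[OF bij_betw_insert_marked bij_betw_star_fill[of "2 * n + 1 + 2"]]
    by (simp add: numeral_3_eq_3)
  moreover have "(star_fill \<circ> insert_marked) x = ?f x" if x: "x \<in> ?X" for x
  proof -
    obtain T e \<epsilon> where x': "x = (T, e, \<epsilon>)" "T \<in> sym_tableaux (2 * n + 1)" "e \<in> lower_edges T"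
      "\<epsilon> \<in> {1, - 1}"
      using x by blast
    obtain D P k c where X: "T = (D, P)" "insertion D P k c" "e = edge_at k c"
      using insertion_of_lower_edge[OF x'(2,3)] by metis
    show ?thesis
      using insertion.insertpoint_star_edge_at[OF X(2) x'(4)]
        insertion.insert_marked_edge_at[OF X(2)] unfolding x'(1) X(1,3) by simp
  qed
  ultimately show ?thesis using bij_betw_cong by blast
qed

end
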